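(* A matroid $M$ is claw-free if and only if $M$ is isomorphic to a matroid that can be obtained, by finitely many applications of the lift-join operation $\otimes$, from matroids each of which is either a PG-sum, an even-plane matroid, or the complement of a triangle-free matroid. Equivalently, $M$ is claw-free if and only if $M$ belongs to the smallest isomorphism-closed class of matroids that contains all PG-sums, all even-plane matroids and all complements of triangle-free matroids, and is closed under lift-joins.
   Context: A matroid is a pair $M=(E,G)$ where $G$ is the set of nonzero vectors of a finite-dimensional $\mathbb F_2$-vector space $V(G)=G\cup\{0\}\cong\mathbb F_2^n$ (the point set of $\mathrm{PG}(n-1,2)$) and $E\subseteq G$. The integer $n\ge 0$ is the dimension of $M$. Two matroids $(E_1,G_1),(E_2,G_2)$ are isomorphic if some linear isomorphism $V(G_1)\to V(G_2)$ maps $E_1$ onto $E_2$. A flat of $G$ is a set $F\subseteq G$ such that $F\cup\{0\}$ is a subspace of $V(G)$; its dimension is the dimension of that subspace. Triangles and planes are flats of dimension $2$ and $3$. The induced restriction of $M$ to a flat $F$ is $M|F=(E\cap F,F)$; $M$ is $N$-free if no induced restriction of $M$ is isomorphic to $N$. A claw is the matroid $(B,G)$ with $G$ of dimension $3$ and $B$ a basis of $V(G)$; $M$ is claw-free if it is $N$-free for $N$ a claw. $M$ is triangle-free if $E$ contains no triangle of $G$. The complement of $M$ is $M^c=(G\setminus E,G)$. $M$ is a PG-sum if $E$ is the disjoint union of two (possibly empty) flats of $G$. $M$ is even-plane if $|E\cap P|$ is even for every plane $P$ of $G$. For $X,Y\subseteq V(G)$, $X+Y=\{x+y:x\in X,y\in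 Y\}$. Lift-join: for matroids $M_1=(E_1,G_1)$, $M_2=(E_2,G_2)$, let $G_1\oplus G_2$ denote the set of nonzero vectors of the vector space direct sum $V(G_1)\oplus V(G_2)$, in which each $V(G_i)$ is identified with its copy; then $M_1\otimes M_2=(E_1\cup(E_2+V(G_1)),\,G_1\oplus G_2)$. *)

theory Defs
  imports
    Complex_Main
    "HOL-Library.Z2"
    "HOL-Library.Product_Plus"
    "HOL-Library.Function_Algebras"
    "HOL-Library.Set_Algebras"
begin

section \<open>Vector spaces over the two-element field\<close>

class f2_vector = ab_group_add +
  fixes scale2 :: "bit \<Rightarrow> 'a \<Rightarrow> 'a"
  assumes scale2_right_distrib: "scale2 a (x + y) = scale2 a x + scale2 a y"
    and scale2_left_distrib: "scale2 (a + b) x = scale2 a x + scale2 b x"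
    and scale2_scale2: "scale2 a (scale2 b x) = scale2 (a * b) x"
    and scale2_one: "scale2 1 x = x"

interpretation f2: vector_space "scale2 :: bit \<Rightarrow> 'a \<Rightarrow> 'a::f2_vector"
  by standard (rule scale2_right_distrib scale2_left_distrib scale2_scale2 scale2_one)+

instantiation bit :: f2_vector
begin
definition "scale2 a (x :: bit) = a * x"
instance
  by standard (simp_all only: scale2_bit_def distrib_left distrib_right mult.assoc mult_1_left)
end

instantiation "fun" :: (type, f2_vector) f2_vector
begin
definition "scale2 a f = (\<lambda>i. scale2 a (f i))"
instance
  by standard
    (simp_all only: scale2_fun_def fun_eq_iff plus_fun_apply scale2_right_distrib
      scale2_left_distrib scale2_scale2 scale2_one simp_thms)
end

instantiation prod :: (f2_vector, f2_vector) f2_vector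
begin
definition "scale2 a p = (scale2 a (fst p), scale2 a (snd p))"
instance
  by standard
    (simp_all only: scale2_prod_def prod_eq_iff fst_add snd_add fst_conv snd_conv
      scale2_right_distrib scale2_left_distrib scale2_scale2 scale2_one simp_thms)
end


section \<open>Matroids\<close>

text \<open>
  A matroid is a pair \<open>(E, G)\<close>. The vector space \<open>V(G) = G \<union> {0}\<close> is a finite-dimensional
  subspace of an arbitrary ambient vector space, given by the type; it need not be the whole type.
\<close>

type_synonym 'a matroid = "'a set \<times> 'a set"

definition vecs :: "'a::f2_vector set \<Rightarrow> 'a set" where
  "vecs G = insert 0 G"

definition matroid :: "'a::f2_vector matroid \<Rightarrow> bool" where
  "matroid = (\<lambda>(E, G). 0 \<notin> G \<and> f2.subspace (vecs G) \<and> (\<exists>B. finite B \<and> f2.span B = vecs G) \<and> E \<subseteq> G)"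

definition matroid_iso :: "'a::f2_vector matroid \<Rightarrow> 'b::f2_vector matroid \<Rightarrow> bool"
    (infix \<open>\<simeq>\<close> 50) where
  "M \<simeq> N \<longleftrightarrow> (case (M, N) of ((E1, G1), (E2, G2)) \<Rightarrow>
     \<exists>f. bij_betw f (vecs G1) (vecs G2) \<and>
         (\<forall>x\<in>vecs G1. \<forall>y\<in>vecs G1. f (x + y) = f x + f y) \<and>
         (\<forall>a. \<forall>x\<in>vecs G1. f (scale2 a x) = scale2 a (f x)) \<and>
         f ` E1 = E2)"

definition flat :: "'a::f2_vector set \<Rightarrow> 'a set \<Rightarrow> bool" where
  "flat G F \<longleftrightarrow> F \<subseteq> G \<and> f2.subspace (vecs F)"

definition flat_dim :: "'a::f2_vector set \<Rightarrow> nat" where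
  "flat_dim F = f2.dim (vecs F)"

definition triangle :: "'a::f2_vector set \<Rightarrow> 'a set \<Rightarrow> bool" where
  "triangle G T \<longleftrightarrow> flat G T \<and> flat_dim T = 2"

definition plane :: "'a::f2_vector set \<Rightarrow> 'a set \<Rightarrow> bool" where
  "plane G P \<longleftrightarrow> flat G P \<and> flat_dim P = 3"

definition induced_restriction :: "'a::f2_vector matroid \<Rightarrow> 'a set \<Rightarrow> 'a matroid" where
  "induced_restriction M F = (fst M \<inter> F, F)"

definition free_of :: "'b::f2_vector matroid \<Rightarrow> 'a::f2_vector matroid \<Rightarrow> bool" where
  "free_of N M \<longleftrightarrow> \<not> (\<exists>F. flat (snd M) F \<and> induced_restriction M F \<simeq> N)"

definition claw :: "'a::f2_vector matroid \<Rightarrow> bool" where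
  "claw N \<longleftrightarrow> matroid N \<and> flat_dim (snd N) = 3 \<and>
     f2.independent (fst N) \<and> f2.span (fst N) = vecs (snd N)"

text \<open>
  The space \<open>nat \<Rightarrow> bit\<close> is infinite-dimensional, so every matroid is isomorphic to one living in it.
\<close>

type_synonym f2_seq = "nat \<Rightarrow> bit"

definition claw_free :: "'a::f2_vector matroid \<Rightarrow> bool" where
  "claw_free M \<longleftrightarrow> (\<forall>N :: f2_seq matroid. claw N \<longrightarrow> free_of N M)"

definition triangle_free :: "'a::f2_vector matroid \<Rightarrow> bool" where
  "triangle_free M \<longleftrightarrow> \<not> (\<exists>T. triangle (snd M) T \<and> T \<subseteq> fst M)"

definition complement :: "'a::f2_vector matroid \<Rightarrow> 'a matroid" where
  "complement M = (snd M - fst M, snd M)"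

definition PG_sum :: "'a::f2_vector matroid \<Rightarrow> bool" where
  "PG_sum M \<longleftrightarrow> (\<exists>F1 F2. flat (snd M) F1 \<and> flat (snd M) F2 \<and> F1 \<inter> F2 = {} \<and> fst M = F1 \<union> F2)"

definition even_plane :: "'a::f2_vector matroid \<Rightarrow> bool" where
  "even_plane M \<longleftrightarrow> (\<forall>P. plane (snd M) P \<longrightarrow> even (card (fst M \<inter> P)))"

definition basic_matroid :: "'a::f2_vector matroid \<Rightarrow> bool" where
  "basic_matroid M \<longleftrightarrow> matroid M \<and>
     (PG_sum M \<or> even_plane M \<or> (\<exists>N. matroid N \<and> triangle_free N \<and> M = complement N))"


section \<open>Lift-joins\<close>

text \<open>The direct sum is the product space; the sum of sets is the pointwise one.\<close>

definition lift_join :: "'a::f2_vector matroid \<Rightarrow> 'b::f2_vector matroid \<Rightarrow> ('a \<times> 'b) matroid" where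
  "lift_join = (\<lambda>(E1, G1) (E2, G2).
     ((\<lambda>x. (x, 0)) ` E1 \<union> ((\<lambda>y. (0, y)) ` E2 + (\<lambda>x. (x, 0)) ` vecs G1),
      vecs G1 \<times> vecs G2 - {0}))"

text \<open>
  Iterating \<open>lift_join\<close> changes the type. To iterate it without bound inside one type, the direct
  sum is carried back to \<open>nat \<Rightarrow> bit\<close> along the linear isomorphism that places the first summand on
  the even coordinates and the second one on the odd coordinates.
\<close>

definition interleave :: "f2_seq \<times> f2_seq \<Rightarrow> f2_seq" where
  "interleave p = (\<lambda>i. if even i then fst p (i div 2) else snd p (i div 2))"

lemma interleave_add: "interleave (p + q) = interleave p + interleave q"
  by (simp add: interleave_def fun_eq_iff)

lemma interleave_scale2: "interleave (scale2 a p) = scale2 a (interleave p)"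
  by (simp add: interleave_def fun_eq_iff scale2_prod_def scale2_fun_def)

lemma bij_interleave: "bij interleave"
proof (rule o_bij)
  let ?g = "\<lambda>u :: f2_seq. (\<lambda>i. u (2 * i), \<lambda>i. u (2 * i + 1))"
  show "?g \<circ> interleave = id"
    by (simp add: interleave_def fun_eq_iff)
  show "interleave \<circ> ?g = id"
    by (auto simp: interleave_def fun_eq_iff elim!: evenE oddE)
qed

definition lift_join_seq :: "f2_seq matroid \<Rightarrow> f2_seq matroid \<Rightarrow> f2_seq matroid"
    (infixr \<open>\<otimes>\<close> 70) where
  "M1 \<otimes> M2 = map_prod (image interleave) (image interleave) (lift_join M1 M2)"

lemma lift_join_iso_lift_join_seq: "lift_join M1 M2 \<simeq> M1 \<otimes> M2"
proof -
  obtain E G where M: "lift_join M1 M2 = (E, G)" by fastforce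
  have "interleave 0 = 0"
    by (simp add: interleave_def fun_eq_iff)
  then have "bij_betw interleave (vecs G) (vecs (interleave ` G))"
    using bij_interleave unfolding vecs_def bij_betw_def
    by (metis image_insert inj_on_subset top_greatest)
  then show ?thesis
    unfolding matroid_iso_def lift_join_seq_def M
    by (auto simp del: add_Pair simp: interleave_add interleave_scale2 intro!: exI[of _ interleave])
qed

inductive obtainable :: "f2_seq matroid \<Rightarrow> bool" where
  basic: "basic_matroid M \<Longrightarrow> obtainable M"
| lift_join: "obtainable M1 \<Longrightarrow> obtainable M2 \<Longrightarrow> obtainable (M1 \<otimes> M2)"

definition lift_join_closed :: "f2_seq matroid set \<Rightarrow> bool" where
  "lift_join_closed C \<longleftrightarrow>
     (\<forall>M\<in>C. matroid M) \<and>
     (\<forall>M\<in>C. \<forall>N. matroid N \<and> M \<simeq> N \<longrightarrow> N \<in> C) \<and>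
     (\<forall>M. basic_matroid M \<longrightarrow> M \<in> C) \<and>
     (\<forall>M1\<in>C. \<forall>M2\<in>C. M1 \<otimes> M2 \<in> C)"

text \<open>
  An isomorphism-closed class of matroids is determined by its members in \<open>nat \<Rightarrow> bit\<close>: a matroid
  over any other type belongs to it iff it is isomorphic to one of these.
\<close>

definition in_class :: "'a::f2_vector matroid \<Rightarrow> f2_seq matroid set \<Rightarrow> bool" where
  "in_class M C \<longleftrightarrow> (\<exists>N\<in>C. M \<simeq> N)"

definition smallest_class :: "f2_seq matroid set" where
  "smallest_class = \<Inter> {C. lift_join_closed C}"

end

theory Submission
  imports Defs
begin

text \<open>
  Call \<open>v \<in> V(G)\<close> red if \<open>v \<in> E\<close> and blue otherwise, and call a subspace \<open>W\<close> a factor if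
  the red set outside \<open>W\<close> is a union of cosets of \<open>W\<close>; lift-join decompositions correspond to
  factors. Induction on the dimension leaves the prime case, where only \<open>{0}\<close> and \<open>V(G)\<close> are
  factors.

  For a blue \<open>b\<close>, a vector \<open>v\<close> has type mixed, red or blue according to whether one, both or none of
  \<open>v\<close> and \<open>v + b\<close> are red. Claw-freeness forbids lines with one point of each type, so colouring the
  edge \<open>uv\<close> by the type of \<open>u + v\<close> gives a colouring without rainbow triangles. As in Gallai's theorem
  one colour class is then disconnected, which means that one of the three types fails to span.
  By primality the mixed type does span. If for some \<open>b\<close> the blue type spans, then the red one spans a
  proper subspace, outside of which the red set is visibly the union of two subspaces, and primality
  makes \<open>M\<close> a PG-sum. Otherwise every \<open>b\<close> in a blue triangle has a hyperplane \<open>H b\<close>, spanned by the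
  vectors of blue type, such that exactly the vectors outside \<open>H b\<close> are mixed. So the indicator function of
  \<open>E\<close> has linear derivatives in the directions of a spanning set, hence is quadratic, and \<open>M\<close> is
  even-plane. If there are no blue triangles, the complement is triangle-free.
\<close>

section \<open>Subspaces over the two-element field\<close>

lemma f2_add_self [simp]: "x + x = (0 :: 'a::f2_vector)"
proof -
  have "x + x = scale2 (1 + 1) x"
    by (simp only: scale2_left_distrib scale2_one)
  then show ?thesis by simp
qed

lemma f2_add_left_self [simp]: "x + (x + y) = (y :: 'a::f2_vector)"
  by (simp flip: add.assoc)

lemma f2_add_left_self2 [simp]: "x + (x + y + z) = y + (z :: 'a::f2_vector)"
  by (simp add: add.assoc)

text \<open>Associativity and commutativity with \<open>x + x = 0\<close> and its extension
  \<open>x + (x + y) = y\<close>: rewriting with these cancels repeated summands anywhere in a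
  sum.\<close>

lemmas f2_ac = add_ac f2_add_self f2_add_left_self add_0_left add_0_right

lemma f2_add_eq_iff: "x + y = z \<longleftrightarrow> x = y + (z :: 'a::f2_vector)"
  by (metis add.commute f2_add_left_self)

lemma f2_add_eq_0_iff: "x + y = 0 \<longleftrightarrow> x = (y :: 'a::f2_vector)"
  by (simp add: f2_add_eq_iff)

lemma f2_subspace_iff: "f2.subspace S \<longleftrightarrow> 0 \<in> S \<and> (\<forall>x\<in>S. \<forall>y\<in>S. x + y \<in> S)"
proof -
  have "scale2 c x \<in> S" if "0 \<in> S" "x \<in> S" for c x
    using that by (cases c) (simp_all add: scale2_one)
  then show ?thesis
    by (auto simp: f2.subspace_def)
qed

lemma f2_subspaceI: "0 \<in> S \<Longrightarrow> (\<And>x y. x \<in> S \<Longrightarrow> y \<in> S \<Longrightarrow> x + y \<in> S) \<Longrightarrow> f2.subspace S"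
  by (simp add: f2_subspace_iff)

lemma f2_subspace_add_iff:
  assumes "f2.subspace S" "y \<in> S"
  shows "x + y \<in> S \<longleftrightarrow> x \<in> S" "y + x \<in> S \<longleftrightarrow> x \<in> S"
  using assms f2_add_left_self unfolding f2_subspace_iff by (metis add.commute)+

text \<open>The vectors whose translation maps \<open>T\<close> into itself form a subspace, so
  invariance can be checked on generators.\<close>

lemma span_translate:
  assumes "\<And>x v. x \<in> X \<Longrightarrow> v \<in> T \<Longrightarrow> v + x \<in> T" and "w \<in> f2.span X" "v \<in> T"
  shows "v + w \<in> T"
proof -
  have "f2.subspace {w. \<forall>v\<in>T. v + w \<in> T}"
    by (rule f2_subspaceI) (auto simp flip: add.assoc)
  moreover have "X \<subseteq> {w. \<forall>v\<in>T. v + w \<in> T}"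
    using assms(1) by auto
  ultimately show ?thesis
    using f2.span_minimal assms(2,3) by blast
qed

text \<open>The set is the union of \<open>K\<close> and \<open>K + b\<close>. It extends an
  alternative "\<open>w\<close> or \<open>w + b\<close> lies in \<open>K\<close>" from generators to
  their span.\<close>

lemma f2_subspace_add_point:
  assumes "f2.subspace K"
  shows "f2.subspace {w. w \<in> K \<or> w + b \<in> K}"
proof (rule f2_subspaceI)
  fix x y
  assume "x \<in> {w. w \<in> K \<or> w + b \<in> K}" "y \<in> {w. w \<in> K \<or> w + b \<in> K}"
  then obtain x' y' where "x' \<in> K" "x' = x \<or> x' = x + b" "y' \<in> K" "y' = y \<or> y' = y + b"
    by blast
  moreover from this have "x' + y' \<in> K"
    using assms by (simp add: f2_subspace_iff)
  ultimately show "x + y \<in> {w. w \<in> K \<or> w + b \<in> K}"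
    by (auto simp: add_ac)
qed (use assms in \<open>simp add: f2_subspace_iff\<close>)

section \<open>Edge colourings without rainbow triangles\<close>

text \<open>Gallai's argument, adding one vertex \<open>v\<close> at a time. \<open>K\<close> holds
  three colours, possibly among others. If all three were connected after adding \<open>v\<close>,
  the components of a colour that was disconnected before would clash with the edges at
  \<open>v\<close>.\<close>

lemma rainbow_free_disconnected:
  fixes c :: "'v \<Rightarrow> 'v \<Rightarrow> 'c"
  assumes "finite S" "2 \<le> card S" and sym: "\<And>x y. c x y = c y x"
    and rainbow_free: "\<And>x y z. x \<in> S \<Longrightarrow> y \<in> S \<Longrightarrow> z \<in> S \<Longrightarrow> x \<noteq> y \<Longrightarrow> y \<noteq> z \<Longrightarrow> x \<noteq> z \<Longrightarrow>
      c x y = c y z \<or> c y z = c x z \<or> c x y = c x z"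
    and K: "card K = 3"
  shows "\<exists>m\<in>K. \<exists>P\<subseteq>S. P \<noteq> {} \<and> P \<noteq> S \<and> (\<forall>x\<in>P. \<forall>y\<in>S - P. c x y \<noteq> m)"
  using assms(1,2) rainbow_free
proof (induction S)
  case (insert v S)
  note rainbow_free = insert.prems(2)
  show ?case
  proof (rule ccontr)
    assume "\<not> ?case"
    then have connected: "\<exists>x\<in>P. \<exists>y\<in>insert v S - P. c x y = m"
      if "m \<in> K" "P \<subseteq> insert v S" "P \<noteq> {}" "P \<noteq> insert v S" for m P
      using that by blast
    have "S \<noteq> {}"
      using insert by auto
    then have neighbour: "\<exists>y\<in>S. c v y = m" if "m \<in> K" for m
      using connected[OF that, of "{v}"] insert.hyps by auto
    have "2 \<le> card S"
    proof (rule ccontr)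
      assume "\<not> 2 \<le> card S"
      then have "card S = 1"
        using \<open>S \<noteq> {}\<close> insert.hyps(1) card_gt_0_iff[of S] by linarith
      then obtain u where "S = {u}"
        by (auto simp: card_Suc_eq)
      then have "K \<subseteq> {c v u}"
        using neighbour by auto
      then have "card K \<le> 1"
        using card_mono[of "{c v u}" K] by simp
      then show False
        using K by simp
    qed
    then obtain m P where m: "m \<in> K" and P: "P \<subseteq> S" "P \<noteq> {}" "P \<noteq> S"
      and cut: "\<And>x y. x \<in> P \<Longrightarrow> y \<in> S - P \<Longrightarrow> c x y \<noteq> m"
      using insert.IH[OF _ rainbow_free] by blast
    \<comment> \<open>\<open>C x\<close> is the component of \<open>x\<close> in \<open>S\<close> in
      colour \<open>m\<close>; the cut \<open>P\<close> is a union of components.\<close>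
    define R where "R = {(x, y). x \<in> S \<and> y \<in> S \<and> c x y = m}"
    define C where "C x = {y. (x, y) \<in> R\<^sup>*}" for x
    have symR: "sym (R\<^sup>*)"
      unfolding R_def by (intro sym_rtrancl symI) (auto simp: sym)
    have C_eq: "y \<in> C x \<longleftrightarrow> x \<in> C y" for x y
      using symR by (auto simp: C_def dest: symD)
    have C_trans: "y \<in> C x \<Longrightarrow> z \<in> C y \<Longrightarrow> z \<in> C x" for x y z
      by (auto simp: C_def)
    have C_refl: "x \<in> C x" for x
      by (simp add: C_def)
    have C_sub: "C x \<subseteq> S" if "x \<in> S" for x
    proof
      fix y
      assume "y \<in> C x"
      then have "(x, y) \<in> R\<^sup>*"
        by (simp add: C_def)
      then show "y \<in> S"
        by (induction rule: rtrancl_induct) (auto simp: R_def that)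
    qed
    have P_closed: "C x \<subseteq> P" if "x \<in> P" for x
    proof
      fix y
      assume "y \<in> C x"
      then have "(x, y) \<in> R\<^sup>*"
        by (simp add: C_def)
      then show "y \<in> P"
        by (induction rule: rtrancl_induct) (use cut in \<open>auto simp: R_def that\<close>)
    qed
    have nbr: "y \<in> C x" if "x \<in> S" "y \<in> S" "c x y = m" for x y
      using that by (auto simp: C_def R_def)
    \<comment> \<open>For an \<open>m\<close>-coloured edge from \<open>y\<close> to
      \<open>y'\<close> inside the component, both edges to the outside vertex \<open>z\<close>
      avoid \<open>m\<close>; the triangle is not rainbow, so they agree.\<close>
    have const: "c x z = c y z" if "x \<in> S" "y \<in> C x" "z \<in> S" "z \<notin> C x" for x y z
    proof -
      have "(x, y) \<in> R\<^sup>*"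
        using that(2) by (simp add: C_def)
      then show ?thesis
      proof (induction rule: rtrancl_induct)
        case (step y y')
        then have y: "y \<in> S" "y' \<in> S" "c y y' = m" "y \<in> C x"
          by (auto simp: R_def C_def)
        then have y': "y' \<in> C x"
          using nbr C_trans by blast
        have "c y z \<noteq> m" "c y' z \<noteq> m" "y \<noteq> z" "y' \<noteq> z"
          using nbr[of y z] nbr[of y' z] C_trans[of y x z] C_trans[of y' x z] that(3,4) y y' by auto
        with y(3) have "c y z = c y' z"
          using rainbow_free[of y y' z] y(1,2) that(3) by (cases "y = y'") auto
        then show ?case
          using step.IH by simp
      qed simp
    qed
    \<comment> \<open>Colour \<open>m\<close> is connected once \<open>v\<close> is added, and no
      \<open>m\<close>-edge in \<open>S\<close> leaves a component, so each component has an
      \<open>m\<close>-edge to \<open>v\<close>.\<close>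
    have touch: "\<exists>y\<in>C x. c v y = m" if "x \<in> S" for x
    proof -
      have "C x \<noteq> {}" "C x \<subseteq> insert v S" "C x \<noteq> insert v S"
        using C_refl C_sub[OF that] insert.hyps by auto
      then obtain p q where pq: "p \<in> C x" "q \<in> insert v S - C x" "c p q = m"
        using connected[OF m, of "C x"] by auto
      moreover have "q = v"
        using pq nbr[of p q] C_trans[of p x q] C_sub[OF that] by auto
      ultimately show ?thesis
        using sym by metis
    qed
    \<comment> \<open>In the triangle \<open>v\<close>, \<open>x\<close>, \<open>z\<close> only the
      edge from \<open>v\<close> to \<open>z\<close> has colour \<open>m\<close>, so the other two
      agree.\<close>
    have transfer: "c x z = c v x" if "x \<in> S" "z \<in> S" "z \<notin> C x" "c v x \<noteq> m" "c v z = m" for x z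
    proof -
      have "c x z \<noteq> m"
        using nbr that by blast
      moreover have "v \<noteq> x" "v \<noteq> z" "x \<noteq> z"
        using that insert.hyps C_refl by auto
      ultimately show ?thesis
        using rainbow_free[of v x z] that by auto
    qed
    have "card (K - {m}) = 2"
      using K m by simp
    then obtain i j where "i \<noteq> j" "i \<in> K - {m}" "j \<in> K - {m}"
      by (auto simp: card_2_iff)
    then obtain x y where x: "x \<in> S" "c v x = i" and y: "y \<in> S" "c v y = j"
      and ij: "i \<noteq> j" "i \<noteq> m" "j \<noteq> m"
      using neighbour by blast
    show False
    \<comment> \<open>In either case \<open>const\<close> equates two edges between different
      components which have colours \<open>i\<close> and \<open>j\<close> by
      \<open>transfer\<close>.\<close>
    proof (cases "y \<in> C x")
      case True
      obtain z0 where "z0 \<in> S" "z0 \<notin> C x"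
        by (cases "x \<in> P") (use P P_closed C_eq x(1) in blast)+
      then obtain z where z: "z \<in> C z0" "c v z = m"
        using touch by blast
      have "z \<in> S"
        using z(1) C_sub[OF \<open>z0 \<in> S\<close>] by (rule subsetD[rotated])
      moreover have "z0 \<in> C z"
        using z(1) by (rule C_eq[THEN iffD1])
      then have "z \<notin> C x"
        using C_trans[of z x z0] \<open>z0 \<notin> C x\<close> by blast
      moreover have "z \<notin> C y"
        using C_trans[OF True] \<open>z \<notin> C x\<close> by blast
      ultimately show False
        using const[of x y z] transfer[of x z] transfer[of y z] x y z True ij by simp
    next
      case False
      obtain x' y' where x': "x' \<in> C x" "c v x' = m" and y': "y' \<in> C y" "c v y' = m"
        using touch x(1) y(1) by blast
      have "x' \<in> S" "y' \<in> S"
        using x'(1) y'(1) C_sub[OF x(1)] C_sub[OF y(1)] by blast+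
      moreover have "x \<notin> C y"
        using C_eq[of x y] False by simp
      moreover have "y \<in> C y'" "x \<in> C x'"
        using C_eq[of y' y] C_eq[of x' x] x'(1) y'(1) by blast+
      then have "y' \<notin> C x" "x' \<notin> C y"
        using C_trans[of y' x y] C_trans[of x' y x] False \<open>x \<notin> C y\<close> by blast+
      ultimately show False
        using const[of x x' y'] const[of y y' x'] transfer[of x y'] transfer[of y x'] x y x' y' ij
          sym[of x' y'] sym[of x y'] sym[of y x'] by simp
    qed
  qed
qed simp

section \<open>Claw-free sets\<close>

text \<open>Dependent triples satisfy \<open>claw\<close> automatically: if two vectors coincide,
  the triple sum is the third one, and if one is the sum of the others, a premise fails.\<close>

locale claw_free_set =
  fixes V E :: "'a::f2_vector set"
  assumes finite_V: "finite V" and subspace_V: "f2.subspace V"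
    and E_sub: "E \<subseteq> V" and zero_E: "0 \<notin> E"
    and claw: "\<lbrakk>x \<in> E; y \<in> E; z \<in> E; x + y \<notin> E; x + z \<notin> E; y + z \<notin> E\<rbrakk> \<Longrightarrow> x + y + z \<in> E"
begin

lemma V_add: "x \<in> V \<Longrightarrow> y \<in> V \<Longrightarrow> x + y \<in> V"
  using subspace_V by (simp add: f2_subspace_iff)

lemma V_zero: "0 \<in> V"
  using subspace_V by (simp add: f2_subspace_iff)

lemma span_sub_V: "X \<subseteq> V \<Longrightarrow> f2.span X \<subseteq> V"
  using subspace_V by (rule f2.span_minimal[rotated])

section \<open>Types of vectors relative to a blue vector\<close>

definition mixed :: "'a \<Rightarrow> 'a set" where
  "mixed b = {v \<in> V. (v \<in> E) \<noteq> (v + b \<in> E)}"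

definition reds :: "'a \<Rightarrow> 'a set" where
  "reds b = {v \<in> V. v \<in> E \<and> v + b \<in> E}"

definition blues :: "'a \<Rightarrow> 'a set" where
  "blues b = {v \<in> V. v \<notin> E \<and> v + b \<notin> E}"

lemma type_sub: "mixed b \<subseteq> V" "reds b \<subseteq> V" "blues b \<subseteq> V"
  by (auto simp: mixed_def reds_def blues_def)

lemma type_cases:
  assumes "v \<in> V"
  obtains "v \<in> mixed b" "v \<notin> reds b" "v \<notin> blues b"
  | "v \<in> reds b" "v \<notin> mixed b" "v \<notin> blues b"
  | "v \<in> blues b" "v \<notin> mixed b" "v \<notin> reds b"
  using assms unfolding mixed_def reds_def blues_def by blast

lemma mixed_shift: "b \<in> V \<Longrightarrow> v \<in> mixed b \<Longrightarrow> v + b \<in> mixed b"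
  and reds_shift: "b \<in> V \<Longrightarrow> v \<in> reds b \<Longrightarrow> v + b \<in> reds b"
  by (auto simp: mixed_def reds_def V_add add.assoc)

text \<open>Otherwise the red one of \<open>a\<close> and \<open>a + b\<close> forms a claw with
  \<open>d\<close> and \<open>d + b\<close>: the pair sums are \<open>b\<close>,
  \<open>a + d\<close> and \<open>a + d + b\<close>, and the triple sum is the blue one of
  \<open>a\<close> and \<open>a + b\<close>.\<close>

lemma no_rainbow:
  assumes b: "b \<in> V" "b \<notin> E" and d: "d \<in> reds b" and a: "a \<in> mixed b"
  shows "a + d \<notin> blues b"
proof
  assume bl: "a + d \<in> blues b"
  show False
  proof (cases "a \<in> E")
    case True
    then show False
      using claw[of d "d + b" a] b d a bl by (auto simp: mixed_def reds_def blues_def add_ac)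
  next
    case False
    then show False
      using claw[of d "d + b" "a + b"] b d a bl by (auto simp: mixed_def reds_def blues_def add_ac)
  qed
qed

text \<open>If \<open>v + w\<close> were blue, then \<open>v + w + b\<close> would be red and form a
  claw with \<open>v\<close> and \<open>w\<close>, with pair sums \<open>v + w\<close>,
  \<open>v + b\<close>, \<open>w + b\<close> and triple sum \<open>b\<close>.\<close>

lemma mixed_add:
  assumes b: "b \<notin> E" and "v \<in> mixed b" "w \<in> mixed b" "v + w \<in> mixed b" "v \<in> E" "w \<in> E"
  shows "v + w \<in> E"
proof (rule ccontr)
  assume "v + w \<notin> E"
  then show False
    using claw[of v w "v + w + b"] assms by (auto simp: mixed_def add_ac)
qed

text \<open>Two types on a line exclude the third by \<open>no_rainbow\<close>; this and the next
  two lemmas are the instances used below.\<close>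

lemma mixed_add_reds:
  assumes "b \<in> V" "b \<notin> E" "d \<in> reds b" "a \<in> mixed b" "a + d \<notin> reds b"
  shows "a + d \<in> mixed b"
  using assms no_rainbow[of b d a] V_add[of a d] type_sub type_cases[of "a + d" b] by blast

lemma mixed_add_blues:
  assumes "b \<in> V" "b \<notin> E" "u \<in> blues b" "a \<in> mixed b" "a + u \<notin> blues b"
  shows "a + u \<in> mixed b"
proof -
  have "a + u \<notin> reds b"
    using no_rainbow[of b "a + u" a] assms by auto
  then show ?thesis
    using assms V_add[of a u] type_sub type_cases[of "a + u" b] by blast
qed

lemma reds_add_mixed:
  assumes "b \<in> V" "b \<notin> E" "d \<in> reds b" "a \<in> mixed b" "d + a \<notin> mixed b"
  shows "d + a \<in> reds b"
  using assms mixed_add_reds[of b d a] by (auto simp: add.commute)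

lemma zero_blues: "b \<notin> E \<Longrightarrow> 0 \<in> blues b" and self_blues: "b \<in> V \<Longrightarrow> b \<notin> E \<Longrightarrow> b \<in> blues b"
  using V_zero zero_E by (auto simp: blues_def)

text \<open>
  In a shortest expression as a sum of elements of \<open>E\<close>, any three summands violate the
  claw condition.
\<close>

lemma span_E_sum_two:
  assumes "v \<in> f2.span E" "v \<noteq> 0" "v \<notin> E"
  shows "\<exists>x\<in>E. \<exists>y\<in>E. v = x + y"
proof -
  define T where "T = insert 0 (E \<union> {x + y | x y. x \<in> E \<and> y \<in> E})"
  have "t + e \<in> T" if "e \<in> E" "t \<in> T" for t e
  proof -
    consider "t = 0" | "t \<in> E" | x y where "x \<in> E" "y \<in> E" "t = x + y"
      using \<open>t \<in> T\<close> by (auto simp: T_def)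
    then show ?thesis
    proof cases
      case 3
      consider "x + y \<in> E" | "x + e \<in> E" | "y + e \<in> E" | "x + y + e \<in> E"
        using claw[of x y e] 3 \<open>e \<in> E\<close> by blast
      then show ?thesis
      proof cases
        case 2
        have "t + e = (x + e) + y" by (simp add: 3 add_ac)
        then show ?thesis using 2 3 unfolding T_def by blast
      next
        case 3
        have "t + e = (y + e) + x" by (simp add: \<open>t = x + y\<close> add_ac)
        then show ?thesis using 3 \<open>x \<in> E\<close> unfolding T_def by blast
      qed (use 3 \<open>e \<in> E\<close> in \<open>auto simp: T_def\<close>)
    qed (use \<open>e \<in> E\<close> in \<open>auto simp: T_def\<close>)
  qed
  then have "0 + v \<in> T"
    using span_translate[of E T v 0] assms(1) by (auto simp: T_def)
  then show ?thesis
    using assms by (auto simp: T_def)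
qed

lemma span_types:
  assumes b: "b \<in> V" "b \<noteq> 0" "b \<notin> E"
  shows "f2.span (mixed b) \<noteq> V \<or> f2.span (reds b) \<noteq> V \<or> f2.span (blues b) \<noteq> V"
proof -
  \<comment> \<open>\<open>X\<close> and \<open>col\<close> number the mixed, red and blue types by
    0, 1 and 2.\<close>
  define X where "X i = (if i = (0::nat) then mixed b else if i = 1 then reds b else blues b)" for i
  define col where
    "col v = (if (v \<in> E) \<noteq> (v + b \<in> E) then 0 else if v \<in> E then 1 else (2::nat))" for v
  have X_sub: "X i \<subseteq> V" for i
    by (simp add: X_def type_sub)
  have col_X: "v \<in> X i \<Longrightarrow> col v = i" if "i \<in> {0, 1, 2}" for v i
    using that by (auto simp: X_def col_def mixed_def reds_def blues_def)
  have rainbow_free: "col p = col q \<or> col q = col (p + q) \<or> col p = col (p + q)"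
    if "p \<in> V" "q \<in> V" for p q
  proof -
    have col: "col a \<in> {0, 1, 2}" for a
      by (simp add: col_def)
    have "col (a + d) \<noteq> 2" if "a \<in> V" "d \<in> V" "col a = 0" "col d = 1" for a d
    proof -
      have "a \<in> mixed b" "d \<in> reds b"
        using that by (auto simp: col_def mixed_def reds_def split: if_splits)
      then have "a + d \<notin> blues b"
        using no_rainbow b by blast
      then show ?thesis
        using V_add[OF that(1,2)] by (auto simp: col_def blues_def)
    qed
    \<comment> \<open>The six instances are the ways to place the mixed and the red type on the line
      through \<open>p\<close> and \<open>q\<close>.\<close>
    from this[of p q] this[of q p] this[of p "p + q"] this[of "p + q" p]
      this[of q "p + q"] this[of "p + q" q]
    show ?thesis
      using that V_add[OF that] col[of p] col[of q] col[of "p + q"]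
      by (auto simp: add_ac)
  qed
  \<comment> \<open>The vertices are the vectors of \<open>V\<close>, and the edge from
    \<open>x\<close> to \<open>y\<close> gets the type of \<open>x + y\<close>. The edges of a
    triangle then form a line, since \<open>(x + y) + (y + z) = x + z\<close>.\<close>
  have "\<exists>m\<in>{0,1,2}. \<exists>P\<subseteq>V. P \<noteq> {} \<and> P \<noteq> V \<and> (\<forall>x\<in>P. \<forall>y\<in>V - P. col (x + y) \<noteq> m)"
  proof (rule rainbow_free_disconnected)
    show "2 \<le> card V"
      using card_mono[of V "{0, b}"] finite_V V_zero b by simp
    fix x y z
    assume "x \<in> V" "y \<in> V" "z \<in> V"
    then show "col (x + y) = col (y + z) \<or> col (y + z) = col (x + z) \<or> col (x + y) = col (x + z)"
      using rainbow_free[of "x + y" "y + z"] V_add by (simp add: add_ac)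
  qed (simp_all add: finite_V add.commute)
  then obtain m P where m: "m \<in> {0, 1, 2}" and P: "P \<subseteq> V" "P \<noteq> {}" "P \<noteq> V"
    and cut: "\<And>x y. x \<in> P \<Longrightarrow> y \<in> V - P \<Longrightarrow> col (x + y) \<noteq> m"
    by blast
  \<comment> \<open>The edge from \<open>p\<close> to \<open>p + x\<close> has colour
    \<open>m\<close> and cannot cross the cut. So \<open>P\<close> is invariant under
    \<open>X m\<close>, which therefore cannot span \<open>V\<close>.\<close>
  have step: "p + x \<in> P" if "x \<in> X m" "p \<in> P" for x p
  proof (rule ccontr)
    assume "p + x \<notin> P"
    moreover have "p + x \<in> V"
      using that P(1) V_add[of p x] X_sub by blast
    ultimately show False
      using cut[of p "p + x"] that col_X[OF m] by auto
  qed
  have "f2.span (X m) \<noteq> V"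
  proof
    assume span: "f2.span (X m) = V"
    obtain p where "p \<in> P"
      using P by blast
    have "V \<subseteq> P"
    proof
      fix v
      assume "v \<in> V"
      then have "p + (p + v) \<in> P"
        using span_translate[of "X m" P "p + v" p] step span V_add \<open>p \<in> P\<close> P by blast
      then show "v \<in> P" by simp
    qed
    then show False using P by blast
  qed
  then show ?thesis
    using m by (auto simp: X_def)
qed

end

section \<open>Prime claw-free sets\<close>

text \<open>A subspace \<open>W\<close> as in the last assumption is a lift-join factor of \<open>(E, V - {0})\<close>.\<close>

locale prime_claw_free_set = claw_free_set +
  assumes E_ne: "E \<noteq> {}"
    and prime: "\<lbrakk>f2.subspace W; W \<subseteq> V; \<And>v w. \<lbrakk>v \<in> V; v \<notin> W; w \<in> W; v \<in> E\<rbrakk> \<Longrightarrow> v + w \<in> E\<rbrakk>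
      \<Longrightarrow> W = {0} \<or> W = V"
begin

lemma span_E: "f2.span E = V"
proof -
  \<comment> \<open>No red vector lies outside \<open>f2.span E\<close>, so it is a factor
    vacuously.\<close>
  have "f2.span E = {0} \<or> f2.span E = V"
    by (rule prime) (use span_sub_V[OF E_sub] f2.span_superset in auto)
  then show ?thesis
    using E_ne zero_E f2.span_superset[of E] by auto
qed

text \<open>If \<open>b = x + y\<close> with \<open>x\<close> and \<open>y\<close> red, then
  \<open>x + b = y\<close>, so \<open>x\<close> has red type.\<close>

lemma reds_nonempty:
  assumes "b \<in> V" "b \<noteq> 0" "b \<notin> E"
  shows "reds b \<noteq> {}"
proof -
  obtain x y where "x \<in> E" "y \<in> E" "b = x + y"
    using span_E_sum_two[of b] assms span_E by blast
  then have "x \<in> reds b"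
    using E_sub by (auto simp: reds_def)
  then show ?thesis by blast
qed

text \<open>The span \<open>W\<close> of \<open>b\<close> and the mixed vectors is a factor: a red
  vector outside \<open>W\<close> has red type, and by \<open>no_rainbow\<close> it keeps this type
  when mixed vectors are added. So \<open>W = V\<close>, and \<open>b\<close> is itself a sum of two
  mixed vectors.\<close>

lemma span_mixed:
  assumes b: "b \<in> V" "b \<noteq> 0" "b \<notin> E"
  shows "f2.span (mixed b) = V"
proof -
  define W where "W = f2.span (insert b (mixed b))"
  have sub: "insert b (mixed b) \<subseteq> W" and WV: "W \<subseteq> V"
    unfolding W_def by (rule f2.span_superset, rule span_sub_V) (use b type_sub in auto)
  have subW: "f2.subspace W"
    by (simp add: W_def)
  have "W = {0} \<or> W = V"
  proof (rule prime[OF subW WV])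
    fix v w
    assume vw: "v \<in> V" "v \<notin> W" "w \<in> W" "v \<in> E"
    have "v + w \<in> {v \<in> V - W. v \<in> E}"
    proof (rule span_translate[of "insert b (mixed b)"])
      fix x v
      assume x: "x \<in> insert b (mixed b)" and v: "v \<in> {v \<in> V - W. v \<in> E}"
      have v': "v \<in> V" "v \<notin> mixed b" "v \<in> reds b"
        using v sub by (auto simp: mixed_def reds_def)
      have "x \<in> W"
        using x sub by blast
      then have out: "v + x \<in> V - W"
        using v V_add[of v x] WV f2_subspace_add_iff(1)[OF subW] by auto
      have "v + x \<in> E"
      proof (cases "x = b")
        case True
        then show ?thesis using v'(3) by (simp add: reds_def)
      next
        case False
        then have "v + x \<in> reds b"
          using reds_add_mixed[of b v x] b v' x out sub by auto
        then show ?thesis by (simp add: reds_def)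
      qed
      then show "v + x \<in> {v \<in> V - W. v \<in> E}"
        using out by simp
    qed (use vw in \<open>auto simp: W_def\<close>)
    then show "v + w \<in> E" by simp
  qed
  then have W: "W = V"
    using sub b by auto
  have "mixed b \<noteq> {}"
  proof
    assume "mixed b = {}"
    then have "V = f2.span {b}"
      using W by (simp add: W_def)
    moreover have "f2.span {b} \<subseteq> {0, b}"
      by (rule f2.span_minimal) (auto intro!: f2_subspaceI)
    ultimately show False
      using E_sub E_ne zero_E b by blast
  qed
  then obtain a where "a \<in> mixed b"
    by blast
  then have "a + (a + b) \<in> f2.span (mixed b)"
    using b mixed_shift by (intro f2.span_add f2.span_base) auto
  then show ?thesis
    using W f2.span_redundant[of b "mixed b"] by (simp add: W_def)
qed

text \<open>The span \<open>W\<close> of the red type is proper. Each coset of \<open>W\<close>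
  outside \<open>W\<close> that contains red vectors has as its red part a translate of one of two
  subspaces \<open>K1\<close>, \<open>K2\<close> of index two in \<open>W\<close>. Collecting the
  red vectors according to which one occurs yields the two flats, and primality makes
  \<open>K1\<close> and \<open>K2\<close> meet in 0 only.\<close>

lemma PG_sum_if_span_blues:
  assumes b: "b \<in> V" "b \<noteq> 0" "b \<notin> E" and span_blues: "f2.span (blues b) = V"
  shows "\<exists>L1 L2. f2.subspace L1 \<and> f2.subspace L2 \<and> L1 \<subseteq> V \<and> L2 \<subseteq> V \<and>
    L1 \<inter> L2 = {0} \<and> E = L1 \<union> L2 - {0}"
proof -
  define W where "W = f2.span (reds b)"
  have subW: "f2.subspace W" and WV: "W \<subseteq> V"
    by (simp_all add: W_def span_sub_V type_sub)
  have W_ne: "W \<noteq> V"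
    using span_types[OF b] span_mixed[OF b] span_blues by (simp add: W_def)
  have W_add: "x + y \<in> W" if "x \<in> W" "y \<in> W" for x y
    using that subW by (simp add: f2_subspace_iff)
  have W_iff: "x + y \<in> W \<longleftrightarrow> x \<in> W" "y + x \<in> W \<longleftrightarrow> x \<in> W" if "y \<in> W" for x y
    using f2_subspace_add_iff[OF subW that] by blast+
  have reds_W: "reds b \<subseteq> W"
    by (simp add: W_def f2.span_superset)
  obtain d where d: "d \<in> reds b"
    using reds_nonempty[OF b] by blast
  have bW: "b \<in> W"
    using d reds_shift[OF b(1) d] reds_W W_add[of d "d + b"] by (auto simp: subset_iff)
  have "0 \<in> W"
    using W_add[OF bW bW] by simp
  \<comment> \<open>Outside \<open>W\<close> there is no red type, so being mixed is preserved by
    red-type translations and hence by \<open>W\<close>.\<close>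
  have mixed_W: "v + w \<in> mixed b" "v + w \<notin> W" if "v \<in> mixed b" "v \<notin> W" "w \<in> W" for v w
  proof -
    have "v + w \<in> mixed b - W"
    proof (rule span_translate[of "reds b"])
      fix x v
      assume x: "x \<in> reds b" and v: "v \<in> mixed b - W"
      have "v + x \<notin> W"
        using x v reds_W W_iff(1)[of x v] by blast
      moreover from this have "v + x \<in> mixed b"
        using mixed_add_reds[of b x v] b v x reds_W by blast
      ultimately show "v + x \<in> mixed b - W" by blast
    qed (use that in \<open>auto simp: W_def\<close>)
    then show "v + w \<in> mixed b" "v + w \<notin> W" by auto
  qed
  have mixed_W_iff: "v + w \<in> mixed b \<longleftrightarrow> v \<in> mixed b" if "v \<notin> W" "w \<in> W" for v w
    using mixed_W[of v w] mixed_W[of "v + w" w] that W_iff(1)[of w v] by (auto simp: add.assoc)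
  have outside: "v \<in> mixed b \<or> v \<in> blues b" if "v \<in> V" "v \<notin> W" for v
    using that reds_W type_cases[of v b] by blast
  have red_mixed: "v \<in> mixed b" if "v \<in> E" "v \<notin> W" for v
    using that outside[of v] E_sub by (auto simp: blues_def)
  have shift_b: "v + b \<notin> E" if "v \<in> E" "v \<notin> W" for v
    using red_mixed[OF that] that by (auto simp: mixed_def)
  \<comment> \<open>Otherwise \<open>v\<close>, \<open>v'\<close>, \<open>w\<close> form a claw:
    \<open>v + v'\<close> and \<open>v + v' + w\<close> lie outside \<open>W\<close> and are not
    mixed, hence are blue.\<close>
  have no_common: "v + w \<in> E \<or> v' + w \<in> E"
    if "v \<in> E" "v' \<in> E" "v + v' \<notin> mixed b" "v + v' \<notin> W" "w \<in> E" "w \<in> W" for v v' w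
  proof (rule ccontr)
    assume neg: "\<not> ?thesis"
    have V: "v + v' \<in> V"
      using that E_sub V_add by blast
    have "v + v' \<notin> E"
      using red_mixed that by blast
    moreover have "v + v' + w \<notin> E"
      using red_mixed[of "v + v' + w"] mixed_W_iff[of "v + v'" w] W_iff(1)[of w "v + v'"] that by blast
    ultimately show False
      using claw[of v v' w] that neg by blast
  qed
  \<comment> \<open>The translations in \<open>W\<close> that preserve the red part of the coset
    \<open>a + W\<close>. One inclusion suffices because every translation is its own
    inverse.\<close>
  define stab where "stab a = {w \<in> W. \<forall>u\<in>W. a + u \<in> E \<longrightarrow> a + u + w \<in> E}" for a
  have stab_sub: "f2.subspace (stab a)" for a
    using \<open>0 \<in> W\<close> by (intro f2_subspaceI) (auto simp: stab_def W_add add.assoc)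
  \<comment> \<open>Failures of invariance at \<open>v + u\<close> and at \<open>v' + u'\<close>
    contradict \<open>no_common\<close> for these two vectors.\<close>
  have E_W_stab: "w \<in> stab v \<or> w \<in> stab v'"
    if "v \<in> E" "v' \<in> E" "v \<notin> W" "v' \<notin> W" "v + v' \<notin> mixed b" "v + v' \<notin> W" "w \<in> E" "w \<in> W" for v v' w
  proof (rule ccontr)
    assume "\<not> ?thesis"
    then obtain u u' where u: "u \<in> W" "v + u \<in> E" "v + u + w \<notin> E"
      and u': "u' \<in> W" "v' + u' \<in> E" "v' + u' + w \<notin> E"
      using \<open>w \<in> W\<close> by (auto simp: stab_def)
    have eq: "(v + u) + (v' + u') = (v + v') + (u + u')"
      by (simp add: add_ac)
    have "(v + u) + (v' + u') \<notin> W" "(v + u) + (v' + u') \<notin> mixed b"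
      unfolding eq using that u u' W_add[of u u'] W_iff(1)[of "u + u'" "v + v'"]
        mixed_W_iff[of "v + v'" "u + u'"] by blast+
    then show False
      using no_common[of "v + u" "v' + u'" w] u u' that by blast
  qed
  have stab_b: "\<not> (w \<in> stab v \<and> w + b \<in> stab v)" if "v \<in> E" "v \<notin> W" for v w
  proof
    assume w: "w \<in> stab v \<and> w + b \<in> stab v"
    then have "w + (w + b) \<in> stab v"
      using stab_sub[of v] by (simp only: f2_subspace_iff)
    then have "v + 0 + b \<in> E"
      using that \<open>0 \<in> W\<close> by (force simp: stab_def)
    then show False
      using shift_b[OF that] by simp
  qed
  \<comment> \<open>By counting: each of \<open>e\<close> and \<open>e + b\<close> lies in at least
    one of the two stabilisers, and each stabiliser contains at most one of them.\<close>
  have split_d: "e \<in> stab v \<longleftrightarrow> e \<notin> stab v'" "e \<in> stab v \<or> e + b \<in> stab v"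
    if "e \<in> reds b" "v \<in> E" "v' \<in> E" "v \<notin> W" "v' \<notin> W" "v + v' \<notin> mixed b" "v + v' \<notin> W" for v v' e
  proof -
    have "e \<in> E" "e + b \<in> E" "e \<in> W" "e + b \<in> W"
      using that(1) reds_W reds_shift[OF b(1) that(1)] by (auto simp: reds_def)
    then have "e \<in> stab v \<or> e \<in> stab v'" "e + b \<in> stab v \<or> e + b \<in> stab v'"
      using E_W_stab that by blast+
    then show "e \<in> stab v \<longleftrightarrow> e \<notin> stab v'" "e \<in> stab v \<or> e + b \<in> stab v"
      using stab_b[of v e] stab_b[of v' e] that by blast+
  qed
  \<comment> \<open>Without such a pair, \<open>W \<union> mixed b\<close> would be a subspace and
    hence contain \<open>V\<close>. All vectors of blue type would then lie in
    \<open>W\<close>.\<close>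
  have "\<exists>a1\<in>E. \<exists>a2\<in>E. a1 \<notin> W \<and> a2 \<notin> W \<and> a1 + a2 \<notin> W \<and> a1 + a2 \<notin> mixed b"
  proof (rule ccontr)
    assume no: "\<not> ?thesis"
    have "x + y \<in> W \<or> x + y \<in> mixed b" if "x \<in> mixed b" "y \<in> mixed b" "x \<notin> W" "y \<notin> W" for x y
    proof -
      obtain x' where x': "x' \<in> E" "x' = x \<or> x' = x + b"
        using \<open>x \<in> mixed b\<close> by (auto simp: mixed_def)
      obtain y' where y': "y' \<in> E" "y' = y \<or> y' = y + b"
        using \<open>y \<in> mixed b\<close> by (auto simp: mixed_def)
      have "x' \<notin> W" "y' \<notin> W"
        using x' y' that W_iff(1)[OF bW] by auto
      then have *: "x' + y' \<in> W \<or> x' + y' \<in> mixed b"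
        using no x' y' by blast
      have "x' + y' = x + y \<or> x' + y' = (x + y) + b"
        using x' y' by (auto simp: add_ac)
      then show ?thesis
        using * W_iff(1)[OF bW, of "x + y"] mixed_W_iff[of "x + y" b] bW by (cases "x + y \<in> W") auto
    qed
    then have "f2.subspace (W \<union> mixed b)"
      using \<open>0 \<in> W\<close> W_add mixed_W_iff W_iff by (intro f2_subspaceI) (metis Un_iff add.commute)+
    then have "f2.span (mixed b) \<subseteq> W \<union> mixed b"
      by (intro f2.span_minimal) auto
    then have "V \<subseteq> W \<union> mixed b"
      using span_mixed[OF b] by simp
    then have "blues b \<subseteq> W"
      by (auto simp: blues_def mixed_def)
    then have "f2.span (blues b) \<subseteq> W"
      using subW by (rule f2.span_minimal)
    then show False
      using span_blues W_ne WV by blast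
  qed
  then obtain a1 a2 where a: "a1 \<in> E" "a2 \<in> E" "a1 \<notin> W" "a2 \<notin> W"
      and a12: "a1 + a2 \<notin> W" "a1 + a2 \<notin> mixed b"
    by blast
  have a21: "a2 + a1 \<notin> W" "a2 + a1 \<notin> mixed b"
    using a12 by (simp_all add: add.commute)
  define K1 where "K1 = stab a1"
  define K2 where "K2 = stab a2"
  have subK: "f2.subspace K1" "f2.subspace K2" and KW: "K1 \<subseteq> W" "K2 \<subseteq> W"
    using stab_sub by (auto simp: K1_def K2_def) (auto simp: stab_def)
  have half: "w \<in> stab v \<or> w + b \<in> stab v"
    if "v \<in> E" "v' \<in> E" "v \<notin> W" "v' \<notin> W" "v + v' \<notin> mixed b" "v + v' \<notin> W" "w \<in> W" for v v' w
  proof -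
    have "W \<subseteq> {w. w \<in> stab v \<or> w + b \<in> stab v}"
      unfolding W_def using split_d(2)[OF _ that(1-6)] f2_subspace_add_point[OF stab_sub]
      by (intro f2.span_minimal) auto
    then show ?thesis
      using that(7) by blast
  qed
  have halfK: "w \<in> K1 \<or> w + b \<in> K1" "w \<in> K2 \<or> w + b \<in> K2" if "w \<in> W" for w
    using half[OF a _ _ that] half[of a2 a1 w] a a12 a21 that by (auto simp: K1_def K2_def)
  \<comment> \<open>\<open>W\<close> is covered by \<open>K\<close> and \<open>K + b\<close>, and
    adding \<open>b\<close> to a red vector outside \<open>W\<close> makes it blue. So once
    \<open>v + K\<close> is red, it is the whole red part of \<open>v + W\<close>.\<close>
  have coset: "v + w \<in> E \<longleftrightarrow> w \<in> K"
    if "v \<notin> W" "w \<in> W" "\<And>w. w \<in> W \<Longrightarrow> w \<in> K \<or> w + b \<in> K" "\<And>k. k \<in> K \<Longrightarrow> v + k \<in> E" for v w K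
  proof
    assume E: "v + w \<in> E"
    show "w \<in> K"
    proof (rule ccontr)
      assume "w \<notin> K"
      then have "v + (w + b) \<in> E"
        using that by blast
      then show False
        using shift_b[OF E] W_iff(1)[of w v] that(1,2) by (simp add: add.assoc)
    qed
  qed (rule that(4))
  have coset_K: "a1 + w \<in> E \<longleftrightarrow> w \<in> K1" "a2 + w \<in> E \<longleftrightarrow> w \<in> K2" if "w \<in> W" for w
  proof -
    have "v + k \<in> E" if "k \<in> stab v" "v \<in> E" for k v
      using that \<open>0 \<in> W\<close> by (force simp: stab_def)
    then show "a1 + w \<in> E \<longleftrightarrow> w \<in> K1" "a2 + w \<in> E \<longleftrightarrow> w \<in> K2"
      using coset[OF _ that] a halfK by (auto simp: K1_def K2_def)
  qed
  \<comment> \<open>If \<open>v + x\<close> is mixed, then \<open>(v + k) + x\<close> is red by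
    \<open>mixed_add\<close>, and adding \<open>v\<close> shows that \<open>x + k\<close> is red
    too.\<close>
  have coset_transfer: "x + w \<in> E \<longleftrightarrow> w \<in> K"
    if v: "v \<in> E" "v \<notin> W" "\<And>w. w \<in> W \<Longrightarrow> v + w \<in> E \<longleftrightarrow> w \<in> K"
      and K: "f2.subspace K" "K \<subseteq> W" "\<And>w. w \<in> W \<Longrightarrow> w \<in> K \<or> w + b \<in> K"
      and x: "x \<in> E" "x \<notin> W" "v + x \<in> W \<or> v + x \<in> mixed b" and w: "w \<in> W" for v K x w
  proof (cases "v + x \<in> W")
    case True
    then have "v + x \<in> K"
      using v(3)[of "v + x"] x by simp
    then show ?thesis
      using v(3)[of "v + x + w"] W_add[OF True w] f2_subspace_add_iff(2)[OF K(1)] by simp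
  next
    case False
    have "x + k \<in> E" if k: "k \<in> K" for k
    proof -
      have kW: "k \<in> W" using k K by blast
      have "v + x + k \<in> mixed b"
        using mixed_W_iff[OF False kW] x False by blast
      moreover have "v + k \<in> E" "v + k \<notin> W"
        using v kW k W_iff(1)[OF kW] by auto
      ultimately have *: "v + x + k \<in> E"
        using mixed_add[of b "v + k" x] b red_mixed x by (simp add: add_ac)
      have "x + k \<in> mixed b"
        using mixed_W_iff[of x k] red_mixed x kW by blast
      then show ?thesis
        using mixed_add[of b v "v + x + k"] * b red_mixed v \<open>v + x + k \<in> mixed b\<close>
        by (simp add: add.assoc)
    qed
    then show ?thesis
      using coset[of x w K] x w K by blast
  qed
  \<comment> \<open>\<open>L K1\<close> and \<open>L K2\<close> will be the two flats, with 0
    included.\<close>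
  define L where "L K = K \<union> {x. x \<notin> W \<and> x \<in> E \<and> (\<forall>w\<in>W. x + w \<in> E \<longleftrightarrow> w \<in> K)}" for K
  have E_W_L: "x \<in> L K1 \<or> x \<in> L K2" if x: "x \<in> E" "x \<notin> W" for x
  proof -
    \<comment> \<open>Otherwise \<open>split_d\<close> would make any two of the stabilisers of
      \<open>x\<close>, \<open>a1\<close>, \<open>a2\<close> disagree about \<open>d\<close>, which
      is impossible for three of them.\<close>
    have "x + a1 \<in> W \<or> x + a1 \<in> mixed b \<or> x + a2 \<in> W \<or> x + a2 \<in> mixed b"
      using split_d(1)[OF d, of x a1] split_d(1)[OF d, of x a2] split_d(1)[OF d, of a1 a2] x a a12
      by blast
    then consider "a1 + x \<in> W \<or> a1 + x \<in> mixed b" | "a2 + x \<in> W \<or> a2 + x \<in> mixed b"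
      by (auto simp: add.commute)
    then show ?thesis
    proof cases
      case 1
      then show ?thesis
        using coset_transfer[OF a(1,3) coset_K(1) subK(1) KW(1) halfK(1) x] x by (simp add: L_def)
    next
      case 2
      then show ?thesis
        using coset_transfer[OF a(2,4) coset_K(2) subK(2) KW(2) halfK(2) x] x by (simp add: L_def)
    qed
  qed
  have sub_L: "f2.subspace (L K)"
    if K: "f2.subspace K" "K \<subseteq> W" "\<And>w. w \<in> W \<Longrightarrow> w \<in> K \<or> w + b \<in> K" for K
  proof -
    have K_add: "x + y \<in> K" if "x \<in> K" "y \<in> K" for x y
      using that K(1) by (simp add: f2_subspace_iff)
    have K_shift: "x + y \<in> L K" if x: "x \<in> L K" "x \<notin> W" and y: "y \<in> K" for x y
    proof -
      have yW: "y \<in> W" using y K by blast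
      have xw: "x + w \<in> E \<longleftrightarrow> w \<in> K" if "w \<in> W" for w
        using x K that by (auto simp: L_def)
      have "x + y + w \<in> E \<longleftrightarrow> w \<in> K" if "w \<in> W" for w
        using xw[of "y + w"] W_add[OF yW that] f2_subspace_add_iff(2)[OF K(1) y, of w]
        by (simp add: add.assoc)
      then show ?thesis
        using x W_iff(1)[OF yW, of x] xw[OF yW] y by (auto simp: L_def)
    qed
    have L_add: "x + y \<in> L K" if x: "x \<in> L K" "x \<notin> W" and y: "y \<in> L K" "y \<notin> W" for x y
    proof -
      have xw: "x + w \<in> E \<longleftrightarrow> w \<in> K" and yw: "y + w \<in> E \<longleftrightarrow> w \<in> K" if "w \<in> W" for w
        using x y K that by (auto simp: L_def)
      have xy: "x \<in> E" "y \<in> E"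
        using x y K by (auto simp: L_def)
      have stab_eq: "stab z = K" if z: "z \<in> E" "\<And>w. w \<in> W \<Longrightarrow> z + w \<in> E \<longleftrightarrow> w \<in> K" for z
      proof
        show "stab z \<subseteq> K"
        proof
          fix w
          assume "w \<in> stab z"
          then show "w \<in> K"
            using z \<open>0 \<in> W\<close> by (force simp: stab_def)
        qed
        show "K \<subseteq> stab z"
          using K(2) K_add z(2) W_add by (auto simp: stab_def add.assoc subset_iff)
      qed
      show ?thesis
      proof (cases "x + y \<in> W")
        case True
        then show ?thesis
          using xw[of "x + y"] xy by (simp add: L_def)
      next
        case False
        \<comment> \<open>Both stabilisers equal \<open>K\<close> and so agree about
          \<open>d\<close>; by \<open>split_d\<close> only the mixed type is left for
          \<open>x + y\<close>.\<close>
        have mixed: "x + y \<in> mixed b"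
          using split_d(1)[OF d, of x y] stab_eq[OF xy(1) xw] stab_eq[OF xy(2) yw] x y xy False
          by blast
        have "x + y + k \<in> E" if "k \<in> K" for k
        proof -
          have kW: "k \<in> W" using that K by blast
          have "x + y + k \<in> mixed b" "y + k \<in> E" "y + k \<notin> W"
            using mixed_W_iff[OF False kW] mixed yw[OF kW] that W_iff(1)[OF kW] y by auto
          then show ?thesis
            using mixed_add[of b x "y + k"] red_mixed x(2) xy b by (simp add: add.assoc)
        qed
        then have xyw: "x + y + w \<in> E \<longleftrightarrow> w \<in> K" if "w \<in> W" for w
          using coset[of "x + y" w K] False that K by blast
        moreover have "x + y \<in> E"
          using xyw[OF \<open>0 \<in> W\<close>] K(1) by (simp add: f2_subspace_iff)
        ultimately show ?thesis
          using False by (simp add: L_def)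
      qed
    qed
    have KL: "K \<subseteq> L K" and LW: "x \<in> K" if "x \<in> L K" "x \<in> W" for x
      using that by (auto simp: L_def)
    show ?thesis
    proof (rule f2_subspaceI)
      show "0 \<in> L K"
        using K(1) by (auto simp: L_def f2_subspace_iff)
      fix x y
      assume xy: "x \<in> L K" "y \<in> L K"
      consider "x \<in> W" "y \<in> W" | "x \<in> W" "y \<notin> W" | "x \<notin> W" "y \<in> W" | "x \<notin> W" "y \<notin> W"
        by blast
      then show "x + y \<in> L K"
      proof cases
        case 1
        then have "x + y \<in> K"
          using xy K_add by (auto simp: L_def)
        then show ?thesis by (simp add: L_def)
      next
        case 2
        then show ?thesis
          using K_shift[of y x] xy by (simp add: L_def add.commute)
      next
        case 3
        then show ?thesis
          using K_shift[of x y] xy by (simp add: L_def)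
      next
        case 4
        then show ?thesis using L_add xy by blast
      qed
    qed
  qed
  have sub_L12: "f2.subspace (L K1)" "f2.subspace (L K2)"
    using sub_L subK KW halfK by blast+
  have E_W: "w \<in> K1 \<or> w \<in> K2" if "w \<in> E" "w \<in> W" for w
    using E_W_stab[of a1 a2 w] a a12 that by (simp add: K1_def K2_def)
  \<comment> \<open>If \<open>k'\<close> were blue, then \<open>a2\<close>, \<open>a2 + k'\<close>
    and \<open>k\<close> would form a claw. The triple sum \<open>k + k'\<close> lies in neither
    \<open>K1\<close> nor \<open>K2\<close>, so it is blue.\<close>
  have swap: "k' \<in> E" if "k \<in> K1" "k \<notin> K2" "k' \<in> K2" "k' \<notin> K1" "k \<in> E"  for k k'
  proof (rule ccontr)
    assume k': "k' \<notin> E"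
    have W: "k \<in> W" "k' \<in> W" "k + k' \<in> W"
      using that KW W_add by blast+
    have notin: "k + k' \<notin> K1" "k + k' \<notin> K2"
      using that f2_subspace_add_iff subK by blast+
    then have "k + k' \<notin> E" using E_W W by blast
    then show False
      using claw[of a2 "a2 + k'" k] coset_K(2)[of k] coset_K(2)[of k'] coset_K(2)[of "k + k'"] a that k' W notin
      by (simp add: add_ac)
  qed
  have swap': "k' \<in> E" if "k \<in> K2" "k \<notin> K1" "k' \<in> K1" "k' \<notin> K2" "k \<in> E"  for k k'
  proof (rule ccontr)
    assume k': "k' \<notin> E"
    have W: "k \<in> W" "k' \<in> W" "k + k' \<in> W"
      using that KW W_add by blast+
    have notin: "k + k' \<notin> K1" "k + k' \<notin> K2"
      using that f2_subspace_add_iff subK by blast+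
    then have "k + k' \<notin> E" using E_W W by blast
    then show False
      using claw[of a1 "a1 + k'" k] coset_K(1)[of k] coset_K(1)[of k'] coset_K(1)[of "k + k'"] a that k' W notin
      by (simp add: add_ac)
  qed
  have dK: "d \<in> K1 \<longleftrightarrow> d \<notin> K2" "d + b \<in> K1 \<longleftrightarrow> d + b \<notin> K2"
    using split_d(1)[OF d, of a1 a2] split_d(1)[OF reds_shift[OF b(1) d], of a1 a2] a a12
    by (simp_all add: K1_def K2_def)
  have dK1: "\<not> (d \<in> K1 \<and> d + b \<in> K1)" "\<not> (d \<in> K2 \<and> d + b \<in> K2)"
    using stab_b a by (simp_all add: K1_def K2_def)
  have dE: "d \<in> E" "d + b \<in> E"
    using d by (auto simp: reds_def)
  obtain e1 e2 where e: "e1 \<in> E" "e1 \<in> K1" "e1 \<notin> K2" "e2 \<in> E" "e2 \<in> K2" "e2 \<notin> K1"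
    using dK dK1 dE by blast
  have sym_diff: "k \<in> E" if "k \<in> K1 \<and> k \<notin> K2 \<or> k \<in> K2 \<and> k \<notin> K1" for k
    using that swap[of e1 k] swap'[of e2 k] e by blast
  have L_W: "x \<in> L K \<Longrightarrow> x \<in> W \<Longrightarrow> x \<in> K" "K \<subseteq> L K" "x \<in> L K \<Longrightarrow> x \<notin> W \<Longrightarrow> K \<subseteq> W \<Longrightarrow> x \<in> E" for x K
    by (auto simp: L_def)
  \<comment> \<open>\<open>J\<close> is a factor: the red vectors of \<open>W\<close> outside
    \<open>J\<close> are exactly those in just one of \<open>K1\<close> and \<open>K2\<close>, and
    outside \<open>W\<close> the red vectors lie in \<open>L K1\<close> or \<open>L K2\<close>, both
    closed under adding \<open>J\<close>.\<close>
  define J where "J = K1 \<inter> K2"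
  have subJ: "f2.subspace J"
    unfolding J_def using subK by (rule f2.subspace_inter)
  have "J = {0} \<or> J = V"
  proof (rule prime[OF subJ])
    show "J \<subseteq> V" using KW WV by (auto simp: J_def)
    fix v w
    assume v: "v \<in> V" "v \<notin> J" "v \<in> E" and w: "w \<in> J"
    have w': "w \<in> K1" "w \<in> K2" "w \<in> W"
      using w KW by (auto simp: J_def)
    show "v + w \<in> E"
    proof (cases "v \<in> W")
      case True
      then show ?thesis
        using E_W[OF v(3)] v(2) w' sym_diff[of "v + w"] f2_subspace_add_iff(1)[OF subK(1) w'(1), of v]
          f2_subspace_add_iff(1)[OF subK(2) w'(2), of v]
        by (auto simp: J_def)
    next
      case False
      then have "v + w \<in> L K1 \<or> v + w \<in> L K2"
        using E_W_L[OF v(3)] w' L_W(2) sub_L12 unfolding f2_subspace_iff by blast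
      then show ?thesis
        using L_W(3) KW W_iff(1)[OF w'(3), of v] False by blast
    qed
  qed
  then have J0: "J = {0}"
    using W_ne WV KW by (auto simp: J_def)
  have "L K1 \<inter> L K2 \<subseteq> J"
  proof
    fix x
    assume x: "x \<in> L K1 \<inter> L K2"
    show "x \<in> J"
    proof (cases "x \<in> W")
      \<comment> \<open>A common vector outside \<open>W\<close> would force \<open>K1 = K2\<close>,
        contrary to the choice of \<open>e1\<close>.\<close>
      case False
      then have "x + w \<in> E \<longleftrightarrow> w \<in> K1" "x + w \<in> E \<longleftrightarrow> w \<in> K2" if "w \<in> W" for w
        using x KW that by (auto simp: L_def)
      then show ?thesis
        using e KW by blast
    qed (use x L_W(1) in \<open>auto simp: J_def\<close>)
  qed
  then have "L K1 \<inter> L K2 = {0}"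
    using J0 sub_L12 by (auto simp: f2_subspace_iff)
  moreover have "E = L K1 \<union> L K2 - {0}"
  proof
    show "E \<subseteq> L K1 \<union> L K2 - {0}"
      using E_W E_W_L L_W(2) zero_E by blast
    show "L K1 \<union> L K2 - {0} \<subseteq> E"
    proof
      fix x
      assume x: "x \<in> L K1 \<union> L K2 - {0}"
      show "x \<in> E"
      proof (cases "x \<in> W")
        case True
        then have "x \<in> K1 \<or> x \<in> K2" "x \<notin> J"
          using x L_W(1) J0 by auto
        then show ?thesis
          using sym_diff by (auto simp: J_def)
      qed (use x L_W(3) KW in blast)
    qed
  qed
  moreover have "L K1 \<subseteq> V" "L K2 \<subseteq> V"
    using KW WV E_sub by (auto simp: L_def)
  ultimately show ?thesis
    using sub_L12 by blast
qed

end

section \<open>Hyperplanes of blue vectors\<close>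

lemma subspace_subset_Un:
  assumes "f2.subspace A" "f2.subspace B" "f2.subspace C" "A \<subseteq> B \<union> C"
  shows "A \<subseteq> B \<or> A \<subseteq> C"
proof (rule ccontr)
  assume "\<not> ?thesis"
  then obtain x y where x: "x \<in> A" "x \<notin> B" and y: "y \<in> A" "y \<notin> C"
    by blast
  then have "x \<in> C" "y \<in> B"
    using assms(4) by blast+
  then have "x + y \<notin> B" "x + y \<notin> C"
    using f2_subspace_add_iff assms(2,3) x y by blast+
  moreover have "x + y \<in> A"
    using x y assms(1) by (simp add: f2_subspace_iff)
  ultimately show False
    using assms(4) by blast
qed

context prime_claw_free_set
begin

text \<open>Suppose two mixed vectors outside the span \<open>W\<close> of the blue type have a sum
  outside \<open>W\<close>. Then a single subspace \<open>K\<close>, of which \<open>W\<close> is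
  the union with \<open>K + b\<close>, describes the red parts of all mixed cosets, and primality
  makes every nonzero vector of \<open>K\<close> red. But \<open>u\<close> or \<open>u + b\<close>
  lies in \<open>K\<close>, and both are blue and nonzero.\<close>

lemma blues_hyperplane:
  assumes b: "b \<in> V" "b \<noteq> 0" "b \<notin> E" and ne: "f2.span (blues b) \<noteq> V"
    and u: "u \<in> blues b" "u \<noteq> 0" "u \<noteq> b"
  shows "V - f2.span (blues b) \<subseteq> mixed b"
    and "\<lbrakk>x \<in> V; y \<in> V; x \<notin> f2.span (blues b); y \<notin> f2.span (blues b)\<rbrakk> \<Longrightarrow> x + y \<in> f2.span (blues b)"
proof -
  define W where "W = f2.span (blues b)"
  have subW: "f2.subspace W" and WV: "W \<subseteq> V"
    by (simp_all add: W_def span_sub_V type_sub)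
  have W_add: "x + y \<in> W" if "x \<in> W" "y \<in> W" for x y
    using that subW by (simp add: f2_subspace_iff)
  have W_iff: "x + y \<in> W \<longleftrightarrow> x \<in> W" "y + x \<in> W \<longleftrightarrow> x \<in> W" if "y \<in> W" for x y
    using f2_subspace_add_iff[OF subW that] by blast+
  have blues_W: "blues b \<subseteq> W"
    by (simp add: W_def f2.span_superset)
  have bW: "b \<in> W"
    using self_blues b blues_W by blast
  have "0 \<in> W"
    using zero_blues b blues_W by blast
  have mixed_W: "v + w \<in> mixed b" if "v \<in> mixed b" "v \<notin> W" "w \<in> W" for v w
  proof -
    have "v + w \<in> mixed b - W"
    proof (rule span_translate[of "blues b"])
      fix x v
      assume x: "x \<in> blues b" and v: "v \<in> mixed b - W"
      have "v + x \<notin> W"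
        using x v blues_W W_iff(1)[of x v] by blast
      moreover from this have "v + x \<in> mixed b"
        using mixed_add_blues[of b x v] b v x blues_W by blast
      ultimately show "v + x \<in> mixed b - W" by blast
    qed (use that in \<open>auto simp: W_def\<close>)
    then show "v + w \<in> mixed b" by auto
  qed
  have mixed_W_iff: "v + w \<in> mixed b \<longleftrightarrow> v \<in> mixed b" if "v \<notin> W" "w \<in> W" for v w
    using mixed_W[of v w] mixed_W[of "v + w" w] that W_iff(1)[of w v] by (auto simp: add.assoc)
  have outside: "v \<in> mixed b \<or> v \<in> reds b" if "v \<in> V" "v \<notin> W" for v
    using that blues_W type_cases[of v b] by blast
  define coset where "coset p = {w \<in> W. p + w \<in> E}" for p
  define stab where "stab p = {w \<in> W. \<forall>u\<in>W. p + u \<in> E \<longrightarrow> p + u + w \<in> E}" for p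
  have stab_sub: "f2.subspace (stab p)" for p
    using \<open>0 \<in> W\<close> by (intro f2_subspaceI) (auto simp: stab_def W_add add.assoc)
  have flip: "w + b \<in> coset p \<longleftrightarrow> w \<notin> coset p" if "p \<in> mixed b" "p \<notin> W" "w \<in> W" for p w
    using mixed_W[OF that] W_add[OF that(3) bW] that(3) by (auto simp: coset_def mixed_def add.assoc)
  have coset_sub_eq: "f2.subspace (coset p) \<and> coset p = coset q"
    if p: "p \<in> E" "p \<in> mixed b" "p \<notin> W" and q: "q \<in> E" "q \<in> mixed b" "q \<notin> W" and pq: "p + q \<notin> W" for p q
  proof (cases "p + q \<in> mixed b")
    case True
    \<comment> \<open>The sum of \<open>p + w\<close> and \<open>q + w'\<close> is red by
      \<open>mixed_add\<close>, and it stays red when \<open>p\<close> or \<open>q\<close> is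
      added.\<close>
    have add: "p + w + w' \<in> E \<and> q + w + w' \<in> E" if "w \<in> coset p" "w' \<in> coset q" for w w'
    proof -
      have W: "w \<in> W" "w' \<in> W" "w + w' \<in> W"
        using that W_add by (auto simp: coset_def)
      have "(p + q) + (w + w') \<in> mixed b" "p + w \<in> mixed b" "q + w' \<in> mixed b"
        "p + (w + w') \<in> mixed b" "q + (w + w') \<in> mixed b"
        using mixed_W[OF True pq W(3)] mixed_W[OF p(2,3)] mixed_W[OF q(2,3)] W by blast+
      moreover have "p + w \<in> E" "q + w' \<in> E"
        using that by (auto simp: coset_def)
      moreover from calculation have pqw: "(p + q) + (w + w') \<in> E"
        using mixed_add[of b "p + w" "q + w'"] b by (simp add: add_ac)
      ultimately show ?thesis
        using mixed_add[of b p "(p + q) + (w + w')"] mixed_add[of b q "(p + q) + (w + w')"] b p q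
        by (simp add: add_ac)
    qed
    have zero: "0 \<in> coset p" "0 \<in> coset q"
      using p q \<open>0 \<in> W\<close> by (auto simp: coset_def)
    have eq: "coset p = coset q"
      using add[OF _ zero(2)] add[OF zero(1)] by (auto simp: coset_def)
    moreover have "f2.subspace (coset p)"
    proof (rule f2_subspaceI[OF zero(1)])
      fix w w'
      assume w: "w \<in> coset p" "w' \<in> coset p"
      then have "w' \<in> coset q"
        using eq by blast
      then show "w + w' \<in> coset p"
        using add[OF w(1)] w W_add by (auto simp: coset_def add.assoc)
    qed
    ultimately show ?thesis by blast
  next
    case False
    \<comment> \<open>In this case \<open>p + q\<close> has red type, and so has its whole coset of
      \<open>W\<close>.\<close>
    have red_sum: "p + q + w \<in> E" if "w \<in> W" for w
      using outside[of "p + q + w"] that mixed_W_iff[OF pq that] False W_iff(1)[OF that, of "p + q"] pq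
        V_add[OF V_add, of p q w] p q WV E_sub by (auto simp: reds_def)
    have stab_b: "\<not> (w \<in> stab r \<and> w + b \<in> stab r)" if "r \<in> E" "r \<in> mixed b" for w r
    proof
      assume w: "w \<in> stab r \<and> w + b \<in> stab r"
      then have "w + (w + b) \<in> stab r"
        using stab_sub[of r] by (simp only: f2_subspace_iff)
      then have "r + 0 + b \<in> E"
        using that \<open>0 \<in> W\<close> by (force simp: stab_def)
      then show False
        using that by (simp add: mixed_def)
    qed
    have stab_or: "w \<in> stab r \<or> w + b \<in> stab s"
      if w: "w \<in> blues b" and rs: "r = p \<and> s = q \<or> r = q \<and> s = p" for w r s
    proof (rule ccontr)
      assume "\<not> ?thesis"
      moreover have wW: "w \<in> W" "w + b \<in> W"
        using w blues_W W_add bW by blast+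
      ultimately obtain u u' where u: "u \<in> W" "r + u \<in> E" "r + u + w \<notin> E"
        and u': "u' \<in> W" "s + u' \<in> E" "s + u' + (w + b) \<notin> E"
        by (auto simp: stab_def)
      have "s \<in> mixed b" "s \<notin> W"
        using rs p q by blast+
      then have "s + u' \<in> mixed b"
        using mixed_W u' by blast
      then have 1: "s + u' + b \<notin> E"
        using u' by (simp add: mixed_def)
      have "r + s = p + q"
        using rs by (auto simp: add.commute)
      then have 2: "r + s + (u + u' + b) \<in> E" "r + s + (u + u' + b + w) \<in> E"
        using red_sum u u' wW bW W_add by simp_all
      have "w \<notin> E" using w by (simp add: blues_def)
      \<comment> \<open>The pair sums of this claw are \<open>s + u' + b\<close>,
        \<open>s + u' + b + w\<close> and \<open>w\<close>, and the triple sum is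
        \<open>r + u + w\<close>.\<close>
      then show False
        using claw[of "r + u" "r + s + (u + u' + b)" "r + s + (u + u' + b + w)"] 1 2 u u'
        by (simp add: add_ac)
    qed
    \<comment> \<open>By \<open>stab_or\<close> in both directions and \<open>stab_b\<close>, the
      two stabilisers contain the same one of \<open>w\<close> and \<open>w + b\<close> for each
      \<open>w\<close> of blue type.\<close>
    define J where "J = stab p \<inter> stab q"
    have "blues b \<subseteq> {w. w \<in> J \<or> w + b \<in> J}"
      using stab_or[of _ p q] stab_or[of _ q p] stab_b[OF p(1,2)] stab_b[OF q(1,2)]
      unfolding J_def by blast
    then have W_J: "W \<subseteq> {w. w \<in> J \<or> w + b \<in> J}"
      unfolding W_def J_def
      by (intro f2.span_minimal f2_subspace_add_point f2.subspace_inter stab_sub)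
    have "coset r = J" if r: "r = p \<or> r = q" for r
    proof
      have "r \<in> E" "r \<in> mixed b" "r \<notin> W"
        using r p q by blast+
      then have stab_coset: "stab r \<subseteq> coset r"
        using \<open>0 \<in> W\<close> by (force simp: stab_def coset_def)
      then show "J \<subseteq> coset r"
        using r by (auto simp: J_def)
      show "coset r \<subseteq> J"
      proof
        fix w
        assume w: "w \<in> coset r"
        then have "w + b \<notin> coset r" "w \<in> W"
          using flip[of r w] \<open>r \<in> mixed b\<close> \<open>r \<notin> W\<close> by (auto simp: coset_def)
        then show "w \<in> J"
          using W_J stab_coset r by (auto simp: J_def)
      qed
    qed
    then show ?thesis
      using stab_sub by (auto simp: J_def intro: f2.subspace_inter)
  qed
  have sum_W: "x + y \<in> W" if xy: "x \<in> mixed b" "y \<in> mixed b" "x \<notin> W" "y \<notin> W" for x y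
  proof (rule ccontr)
    assume xyW: "x + y \<notin> W"
    have "\<exists>x'. x' \<in> E \<and> x' \<in> mixed b \<and> x' \<notin> W \<and> x + x' \<in> W" if "x \<in> mixed b" "x \<notin> W" for x
    proof (cases "x \<in> E")
      case True
      then show ?thesis using that \<open>0 \<in> W\<close> by (intro exI[of _ x]) simp
    next
      case False
      then show ?thesis
        using that mixed_shift[OF b(1)] bW W_iff(1)[OF bW, of x]
        by (intro exI[of _ "x + b"]) (auto simp: mixed_def)
    qed
    then obtain p q where p: "p \<in> E" "p \<in> mixed b" "p \<notin> W" "x + p \<in> W"
      and q: "q \<in> E" "q \<in> mixed b" "q \<notin> W" "y + q \<in> W"
      using xy by metis
    have "x + y + ((x + p) + (y + q)) \<notin> W"
      using xyW W_iff(1)[OF W_add[OF p(4) q(4)], of "x + y"] by blast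
    then have pq: "p + q \<notin> W"
      by (simp add: add_ac)
    define K where "K = coset p"
    have subK: "f2.subspace K" and Kq: "coset q = K"
      using coset_sub_eq[OF p(1-3) q(1-3) pq] by (auto simp: K_def)
    have KW: "K \<subseteq> W"
      by (auto simp: K_def coset_def)
    \<comment> \<open>As \<open>p + q\<close> lies outside \<open>W\<close>, so does at least one of
      \<open>p + z\<close> and \<open>q + z\<close>.\<close>
    have coset_K: "coset z = K" if z: "z \<in> E" "z \<in> mixed b" "z \<notin> W" for z
    proof (cases "p + z \<in> W")
      case True
      have "q + z \<notin> W"
        using W_add[OF True, of "q + z"] pq by (auto simp: add_ac)
      then show ?thesis
        using coset_sub_eq[OF q(1-3) z] Kq by simp
    qed (use coset_sub_eq[OF p(1-3) z] K_def in simp)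
    have K_flip: "w + b \<in> K \<longleftrightarrow> w \<notin> K" if "w \<in> W" for w
      using flip[OF p(2,3) that] by (simp add: K_def)
    have bK: "b \<notin> K"
      using K_flip[OF \<open>0 \<in> W\<close>] subK by (simp add: f2_subspace_iff)
    have K_outside: "v + k \<in> E" if v: "v \<in> E" "v \<notin> W" and k: "k \<in> K" for v k
    proof (cases "v \<in> mixed b")
      case True
      then show ?thesis
        using coset_K[OF v(1) True v(2)] k by (auto simp: coset_def)
    next
      case False
      have kW: "k \<in> W" using k KW by blast
      have "v \<in> V" "k \<in> V" using v kW E_sub WV by auto
      then show ?thesis
        using outside[OF V_add[of v k]] mixed_W_iff[OF v(2) kW] W_iff(1)[OF kW, of v] False v
        by (auto simp: reds_def)
    qed
    \<comment> \<open>Otherwise \<open>y\<close>, \<open>p\<close> and \<open>p + k\<close> form a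
      claw with pair sums \<open>p + y\<close>, \<open>p + y + k\<close> and
      \<open>k\<close>.\<close>
    have K_blue: "y + k \<in> E" if k: "k \<in> K" "k \<notin> E" and y: "y \<in> W" "y \<notin> K" "y \<in> E" for y k
    proof (rule ccontr)
      assume yk: "y + k \<notin> E"
      have kW: "k \<in> W" using k KW by blast
      have "y + k \<notin> K" "y + k \<in> W"
        using f2_subspace_add_iff(1)[OF subK k(1), of y] y W_add[OF _ kW] by blast+
      then have "p + y \<notin> E" "p + (y + k) \<notin> E" "p + k \<in> E"
        using y k by (auto simp: K_def coset_def)
      then show False
        using claw[of y p "p + k"] y p k yk by (simp add: add_ac)
    qed
    \<comment> \<open>By \<open>K_blue\<close>, \<open>S\<close> contains all blue vectors of
      \<open>K\<close>. It is a factor, because the red set is also invariant under \<open>K\<close>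
      outside \<open>W\<close>, and the vectors of \<open>K\<close> outside \<open>S\<close> are all
      red.\<close>
    define S where "S = {s \<in> K. \<forall>y\<in>W - K. y \<in> E \<longrightarrow> y + s \<in> E}"
    have SK: "S \<subseteq> K" by (auto simp: S_def)
    have subS: "f2.subspace S"
    proof (rule f2_subspaceI)
      show "0 \<in> S"
        using subK by (simp add: S_def f2_subspace_iff)
      fix s t
      assume s: "s \<in> S" and t: "t \<in> S"
      have "y + (s + t) \<in> E" if y: "y \<in> W - K" "y \<in> E" for y
      proof -
        have "s \<in> K" "s \<in> W"
          using s SK KW by blast+
        then have "y + s \<in> W - K" "y + s \<in> E"
          using y s f2_subspace_add_iff(1)[OF subK, of s y] W_add by (auto simp: S_def)
        then show ?thesis
          using t by (simp add: S_def flip: add.assoc)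
      qed
      then show "s + t \<in> S"
        using s t subK by (simp add: S_def f2_subspace_iff)
    qed
    have "S = {0} \<or> S = V"
    proof (rule prime[OF subS])
      show "S \<subseteq> V" using SK KW WV by blast
      fix v s
      assume v: "v \<in> V" "v \<notin> S" "v \<in> E" and s: "s \<in> S"
      have sK: "s \<in> K" using s SK by blast
      consider "v \<notin> W" | "v \<in> W - K" | "v \<in> K" using KW by blast
      then show "v + s \<in> E"
      proof cases
        case 1
        then show ?thesis using K_outside v sK by blast
      next
        case 2
        then show ?thesis using s v by (simp add: S_def)
      next
        case 3
        have "v + s \<in> K" "v + s \<notin> S"
          using 3 v s sK f2_subspace_add_iff(1) subK subS by blast+
        then show ?thesis
          using K_blue by (auto simp: S_def)
      qed
    qed
    then have S0: "S = {0}"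
      using bK b SK by blast
    have K_red: "k \<in> E" if "k \<in> K" "k \<noteq> 0" for k
      using that S0 K_blue[of k] by (auto simp: S_def)
    have "u \<in> W" "u \<notin> E" "u + b \<notin> E" "u + b \<noteq> 0"
      using u blues_W by (auto simp: blues_def f2_add_eq_0_iff)
    then show False
      using K_flip[of u] K_red[of u] K_red[of "u + b"] u(2) by blast
  qed
  have "f2.subspace (W \<union> mixed b)"
  proof (rule f2_subspaceI)
    fix x y
    assume xy: "x \<in> W \<union> mixed b" "y \<in> W \<union> mixed b"
    consider "x \<in> W" "y \<in> W" | "x \<in> W" "y \<notin> W" | "x \<notin> W" "y \<in> W" | "x \<notin> W" "y \<notin> W"
      by blast
    then show "x + y \<in> W \<union> mixed b"
      using xy W_add[of x y] sum_W[of x y] mixed_W[of x y] mixed_W[of y x]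
      by cases (auto simp: add.commute)
  qed (use \<open>0 \<in> W\<close> in simp)
  then have "f2.span (mixed b) \<subseteq> W \<union> mixed b"
    by (intro f2.span_minimal) auto
  then have *: "V - W \<subseteq> mixed b"
    using span_mixed[OF b] by auto
  then show "V - f2.span (blues b) \<subseteq> mixed b"
    by (simp add: W_def)
  show "x + y \<in> f2.span (blues b)"
    if "x \<in> V" "y \<in> V" "x \<notin> f2.span (blues b)" "y \<notin> f2.span (blues b)"
    using sum_W[of x y] that * by (auto simp: W_def)
qed

text \<open>The vectors of blue triangles, with \<open>b\<close>, \<open>u\<close> and
  \<open>u + b\<close> as the triangle. Excluding \<open>0\<close> and \<open>b\<close> is
  essential, since both always have blue type relative to a blue \<open>b\<close>.\<close>

definition centre :: "'a \<Rightarrow> bool" where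
  "centre b \<longleftrightarrow> b \<in> V \<and> b \<noteq> 0 \<and> b \<notin> E \<and> (\<exists>u\<in>blues b. u \<noteq> 0 \<and> u \<noteq> b)"

end

section \<open>Linear derivatives in the directions of blue triangles\<close>

locale non_PG_sum_set = prime_claw_free_set +
  assumes span_blues: "centre b \<Longrightarrow> f2.span (blues b) \<noteq> V"
begin

abbreviation H :: "'a \<Rightarrow> 'a set" where
  "H b \<equiv> f2.span (blues b)"

lemma centre_dest: "centre b \<Longrightarrow> b \<in> V \<and> b \<noteq> 0 \<and> b \<notin> E"
  by (simp add: centre_def)

lemma H_sub: "H b \<subseteq> V"
  by (simp add: span_sub_V type_sub)

lemma blues_H: "blues b \<subseteq> H b"
  by (rule f2.span_superset)

lemma self_H: "centre b \<Longrightarrow> b \<in> H b"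
  using centre_dest self_blues blues_H by blast

lemma H_iff: "y \<in> H b \<Longrightarrow> x + y \<in> H b \<longleftrightarrow> x \<in> H b"
  by (rule f2_subspace_add_iff(1)[OF f2.subspace_span])

lemma outside_exists: "centre b \<Longrightarrow> \<exists>v\<in>V. v \<notin> H b"
  using span_blues H_sub by blast

lemma outside_mixed: "centre b \<Longrightarrow> v \<in> V \<Longrightarrow> v \<notin> H b \<Longrightarrow> v \<in> mixed b"
  using blues_hyperplane(1) span_blues unfolding centre_def by blast

lemma outside_add: "centre b \<Longrightarrow> v \<in> V \<Longrightarrow> w \<in> V \<Longrightarrow> v \<notin> H b \<Longrightarrow> w \<notin> H b \<Longrightarrow> v + w \<in> H b"
  using blues_hyperplane(2) span_blues unfolding centre_def by blast

lemma H_add_iff: "centre b \<Longrightarrow> v \<in> V \<Longrightarrow> w \<in> V \<Longrightarrow> v + w \<in> H b \<longleftrightarrow> (v \<in> H b \<longleftrightarrow> w \<in> H b)"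
  using outside_add H_iff by (metis add.commute)

lemma H_maximal:
  assumes "centre b" "f2.subspace S" "H b \<subseteq> S" "v \<in> S" "v \<in> V" "v \<notin> H b"
  shows "V \<subseteq> S"
proof
  fix w
  assume "w \<in> V"
  then have "w \<in> H b \<or> v + w \<in> H b"
    using outside_add assms by blast
  then show "w \<in> S"
    using f2_subspace_add_iff(2)[OF assms(2,4)] assms(3) by blast
qed

lemma centre_blues:
  assumes b: "centre b" and u: "u \<in> blues b" "u \<noteq> 0" "u \<noteq> b"
  shows "centre u" "b \<in> blues u" "centre (u + b)" "u + b \<in> blues b" "u + b \<noteq> 0" "u + b \<noteq> b"
    "b \<in> blues (u + b)"
  using b u V_add unfolding centre_def by (auto simp: blues_def f2_add_eq_iff add_ac)

text \<open>As \<open>v + u\<close> lies outside \<open>H b\<close>, the vectors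
  \<open>v + u\<close> and \<open>v + u + b\<close> have different colours. If \<open>v\<close> were
  outside both other hyperplanes, each of them would have the colour opposite to that of
  \<open>v\<close>.\<close>

lemma triangle_cover:
  assumes b: "centre b" and u: "u \<in> blues b" "u \<noteq> 0" "u \<noteq> b" and v: "v \<in> V" "v \<notin> H b"
  shows "v \<in> H u \<or> v \<in> H (u + b)"
proof (rule ccontr)
  assume "\<not> ?thesis"
  then have "v \<in> mixed u" "v \<in> mixed (u + b)"
    using outside_mixed centre_blues[OF b u] v by blast+
  moreover have "v + u \<in> mixed b"
    using outside_mixed[OF b, of "v + u"] v u blues_H H_iff type_sub V_add by blast
  ultimately show False
    by (auto simp: mixed_def add_ac)
qed

text \<open>Translating by a common vector \<open>v\<close> turns \<open>triangle_cover\<close> into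
  an inclusion of \<open>H b\<close> in the union of the other two hyperplanes. One of them would
  then contain both \<open>H b\<close> and \<open>v\<close>, hence \<open>V\<close>.\<close>

lemma triangle_not_both:
  assumes b: "centre b" and u: "u \<in> blues b" "u \<noteq> 0" "u \<noteq> b" and v: "v \<in> V" "v \<notin> H b"
  shows "\<not> (v \<in> H u \<and> v \<in> H (u + b))"
proof
  assume v': "v \<in> H u \<and> v \<in> H (u + b)"
  have "H b \<subseteq> H u \<union> H (u + b)"
  proof
    fix w
    assume w: "w \<in> H b"
    then have "w + v \<notin> H b" "w + v \<in> V"
      using v H_sub V_add H_iff[of w b v] by (auto simp: add.commute)
    then have "w + v \<in> H u \<or> w + v \<in> H (u + b)"
      using triangle_cover[OF b u] by blast
    then show "w \<in> H u \<union> H (u + b)"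
      using v' H_iff by blast
  qed
  then have "H b \<subseteq> H u \<or> H b \<subseteq> H (u + b)"
    by (intro subspace_subset_Un) simp_all
  then have "V \<subseteq> H u \<or> V \<subseteq> H (u + b)"
    using H_maximal[OF b _ _ _ v] v' by (meson f2.subspace_span)
  then show False
    using outside_exists centre_blues[OF b u] by blast
qed

lemma outside_shift:
  assumes b: "centre b" and u: "u \<in> blues b" "u \<noteq> 0" "u \<noteq> b" and v: "v \<in> V" "v \<notin> H b"
  shows "v \<in> mixed u \<longleftrightarrow> v \<notin> H u"
proof
  assume "v \<notin> H u"
  then show "v \<in> mixed u"
    using outside_mixed centre_blues[OF b u] v by blast
next
  assume mixed: "v \<in> mixed u"
  show "v \<notin> H u"
  proof
    assume "v \<in> H u"
    \<comment> \<open>Now the colour count of \<open>triangle_cover\<close> applies again: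
      \<open>v\<close> is mixed for \<open>u\<close> and for \<open>u + b\<close>.\<close>
    then have "v \<in> mixed (u + b)"
      using triangle_not_both[OF b u v] outside_mixed centre_blues[OF b u] v by blast
    moreover have "v + u \<in> mixed b"
      using outside_mixed[OF b, of "v + u"] v u blues_H H_iff type_sub V_add by blast
    ultimately show False
      using mixed by (auto simp: mixed_def add_ac)
  qed
qed

text \<open>This is \<open>outside_shift\<close> with \<open>b\<close> and \<open>u\<close>
  exchanged: outside \<open>H u\<close>, being mixed for \<open>b\<close> means lying outside
  \<open>H b\<close>.\<close>

lemma mixed_inside:
  assumes b: "centre b" and u: "u \<in> blues b" "u \<noteq> 0" "u \<noteq> b" and w: "w \<in> H b" "w \<in> mixed b"
  shows "w \<in> H u"
  using outside_shift[of u b w] centre_blues[OF b u] w b u H_sub unfolding centre_def by blast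

text \<open>If \<open>H b\<close> were inside \<open>H u\<close>, the complement of
  \<open>H b\<close> would avoid \<open>H u\<close> and so lie in \<open>H (u + b)\<close> by
  \<open>triangle_cover\<close>. But the complement of a hyperplane generates
  \<open>V\<close>.\<close>

lemma H_not_sub:
  assumes b: "centre b" and u: "u \<in> blues b" "u \<noteq> 0" "u \<noteq> b"
  shows "\<not> H b \<subseteq> H u"
proof
  assume sub: "H b \<subseteq> H u"
  obtain v where v: "v \<in> V" "v \<notin> H b"
    using outside_exists b by blast
  have out: "x \<in> H (u + b)" if "x \<in> V" "x \<notin> H b" for x
  proof -
    have "x \<notin> H u"
      using H_maximal[OF b f2.subspace_span sub _ that] outside_exists centre_blues(1)[OF b u] by blast
    then show ?thesis
      using triangle_cover[OF b u that] by blast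
  qed
  have "H b \<subseteq> H (u + b)"
  proof
    fix w
    assume w: "w \<in> H b"
    then have "w + v \<notin> H b" "w + v \<in> V"
      using v H_sub V_add H_iff[of w b v] by (auto simp: add.commute)
    then show "w \<in> H (u + b)"
      using out[OF v] out[of "w + v"] H_iff by blast
  qed
  then have "V \<subseteq> H (u + b)"
    using H_maximal[OF b f2.subspace_span _ out[OF v] v] by blast
  then show False
    using outside_exists centre_blues[OF b u] by blast
qed

text \<open>The span \<open>Y\<close> of the offending vectors is proper in \<open>H b\<close> by
  \<open>mixed_inside\<close> and \<open>H_not_sub\<close>. The vectors of \<open>Y\<close> that
  preserve the red set outside \<open>H b\<close> form a factor \<open>S\<close>, so
  \<open>S = {0}\<close>; yet \<open>S\<close> contains \<open>x\<close> or \<open>x + b\<close> for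
  every offending \<open>x\<close>, which leaves only \<open>0\<close> and \<open>b\<close>.\<close>

lemma inside_not_mixed:
  assumes b: "centre b"
  shows "H b \<inter> mixed b = {}"
proof (rule ccontr)
  assume ne: "H b \<inter> mixed b \<noteq> {}"
  define A where "A = H b \<inter> mixed b"
  define Y where "Y = f2.span A"
  obtain a where a: "a \<in> A" using ne by (auto simp: A_def)
  obtain u where u: "u \<in> blues b" "u \<noteq> 0" "u \<noteq> b"
    using b by (auto simp: centre_def)
  note b' = centre_dest[OF b]
  have subY: "f2.subspace Y" by (simp add: Y_def)
  have AY: "A \<subseteq> Y" by (simp add: Y_def f2.span_superset)
  have YH: "Y \<subseteq> H b" and "Y \<subseteq> H u"
    unfolding Y_def A_def using mixed_inside[OF b u] by (intro f2.span_minimal f2.subspace_span, blast)+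
  then have Y_ne: "\<not> H b \<subseteq> Y"
    using H_not_sub[OF b u] by blast
  have Y_iff: "x + y \<in> Y \<longleftrightarrow> x \<in> Y" if "y \<in> Y" for x y
    using f2_subspace_add_iff(1)[OF subY that] .
  have bH: "b \<in> H b" using self_H b .
  have A_shift: "x + b \<in> A" if "x \<in> A" for x
    using that mixed_shift b' H_iff[OF bH] by (auto simp: A_def)
  have bY: "b \<in> Y"
    using Y_iff[of a b] a A_shift[OF a] AY by (metis Y_iff add.commute subsetD)
  \<comment> \<open>Nothing in \<open>H b - Y\<close> is mixed, so a vector of red type there keeps
    its type when elements of \<open>A\<close> are added.\<close>
  have Y_outside: "v + y \<in> E" if "v \<in> H b" "v \<notin> Y" "v \<in> E" "y \<in> Y" for v y
  proof -
    have "v + y \<in> {v \<in> H b - Y. v \<in> E}"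
    proof (rule span_translate[of A])
      fix x v
      assume x: "x \<in> A" and v: "v \<in> {v \<in> H b - Y. v \<in> E}"
      have out: "v + x \<in> H b - Y"
        using x v AY Y_iff[of x v] H_iff[of x b v] by (auto simp: A_def)
      then have "v \<in> reds b" "v + x \<notin> mixed b"
        using v AY H_sub by (auto simp: A_def mixed_def reds_def)
      then have "v + x \<in> reds b"
        using reds_add_mixed[of b v x] b' x by (auto simp: A_def)
      then show "v + x \<in> {v \<in> H b - Y. v \<in> E}"
        using out by (simp add: reds_def)
    qed (use that in \<open>auto simp: Y_def\<close>)
    then show ?thesis by simp
  qed
  have out_V: "v + y \<in> V" "v + y \<notin> H b" if "v \<in> V" "v \<notin> H b" "y \<in> H b" for v y
    using that V_add H_sub H_iff by blast+
  define S where "S = {s \<in> Y. \<forall>v\<in>V - H b. v \<in> E \<longrightarrow> v + s \<in> E}"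
  have SY: "S \<subseteq> Y" by (auto simp: S_def)
  have subS: "f2.subspace S"
  proof (rule f2_subspaceI)
    show "0 \<in> S"
      using subY by (simp add: S_def f2_subspace_iff)
    fix s t
    assume st: "s \<in> S" "t \<in> S"
    have "v + (s + t) \<in> E" if v: "v \<in> V - H b" "v \<in> E" for v
    proof -
      have "v + s \<in> V - H b" "v + s \<in> E"
        using v st out_V[of v s] YH by (auto simp: S_def)
      then show ?thesis
        using st by (simp add: S_def flip: add.assoc)
    qed
    then show "s + t \<in> S"
      using st subY by (simp add: S_def f2_subspace_iff)
  qed
  have A_red: "x \<in> S" if "x \<in> A" "x \<in> E" for x
  proof -
    have "v + x \<in> E" if v: "v \<in> V - H b" "v \<in> E" for v
    proof -
      have "v \<in> mixed b" "v + x \<in> mixed b"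
        using outside_mixed[OF b] out_V v \<open>x \<in> A\<close> by (auto simp: A_def)
      then show ?thesis
        using mixed_add[of b v x] b' v \<open>x \<in> A\<close> \<open>x \<in> E\<close> by (auto simp: A_def)
    qed
    then show ?thesis using that AY by (auto simp: S_def)
  qed
  have A_S: "x \<in> S \<or> x + b \<in> S" if "x \<in> A" for x
    using A_red[OF that] A_red[OF A_shift[OF that]] that by (auto simp: A_def mixed_def)
  have Y_S: "y \<in> S \<or> y + b \<in> S" if "y \<in> Y" for y
  proof -
    have "Y \<subseteq> {w. w \<in> S \<or> w + b \<in> S}"
      unfolding Y_def using A_S f2_subspace_add_point[OF subS] by (intro f2.span_minimal) auto
    then show ?thesis using that by blast
  qed
  have mixed_b: "v + b \<in> E \<longleftrightarrow> v \<notin> E" if "v \<in> V" "v \<notin> H b" for v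
    using outside_mixed[OF b that] by (auto simp: mixed_def)
  obtain v0 where v0: "v0 \<in> V" "v0 \<notin> H b" "v0 \<in> E"
    using outside_exists[OF b] mixed_b out_V bH by metis
  have bS: "b \<notin> S"
    using v0 mixed_b by (auto simp: S_def)
  \<comment> \<open>Adding \<open>y\<close> would flip every colour outside \<open>H b\<close>,
    since \<open>y + b\<close> preserves the red set there and \<open>b\<close> flips it. For
    \<open>u\<close> of blue type outside \<open>Y\<close>, let \<open>t\<close> be the red one of
    \<open>v0 + u\<close> and \<open>v0 + u + y\<close>; then \<open>y\<close>, \<open>v0\<close>,
    \<open>t\<close> form a claw.\<close>
  have Y_blue: "y \<notin> E" if y: "y \<in> Y" "y \<notin> S" for y
  proof
    assume yE: "y \<in> E"
    have yb: "y + b \<in> S" using Y_S y by blast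
    have yH: "y \<in> H b" using y YH by blast
    have flip: "v + y \<in> E \<longleftrightarrow> v \<notin> E" if v: "v \<in> V" "v \<notin> H b" for v
    proof
      assume "v + y \<in> E"
      then have "v + y + (y + b) \<in> E"
        using yb out_V[OF v yH] by (simp add: S_def)
      then show "v \<notin> E"
        using mixed_b[OF v] by (simp add: add_ac)
    next
      assume "v \<notin> E"
      then have "v + b + (y + b) \<in> E"
        using yb out_V[OF v bH] mixed_b[OF v] by (simp add: S_def)
      then show "v + y \<in> E" by (simp add: add_ac)
    qed
    have "\<not> blues b \<subseteq> Y"
      using f2.span_minimal[OF _ subY] Y_ne by blast
    then obtain u where u: "u \<in> blues b" "u \<notin> Y" by blast
    then have uH: "u \<in> H b" and uE: "u \<notin> E"
      using blues_H by (auto simp: blues_def)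
    have uyE: "u + y \<notin> E"
      using Y_outside[of "u + y" y] uE u(2) Y_iff[OF y(1)] H_iff[OF yH] uH y(1) by (auto simp: add.assoc)
    have claw': False if "t \<in> E" "t = v0 + u \<or> t = v0 + u + y" for t
    proof -
      have t: "t \<in> V" "t \<notin> H b"
        using that out_V[OF v0(1,2) uH] out_V[OF _ _ yH] by blast+
      then have "t + y \<notin> E" "v0 + y \<notin> E"
        using flip \<open>t \<in> E\<close> v0 by blast+
      then show False
        using claw[of y v0 t] yE v0 that uE uyE by (auto simp: add_ac)
    qed
    then show False
      using flip[OF out_V[OF v0(1,2) uH]] by blast
  qed
  have "S = {0} \<or> S = V"
  proof (rule prime[OF subS])
    show "S \<subseteq> V" using SY YH H_sub by blast
    fix v s
    assume v: "v \<in> V" "v \<notin> S" "v \<in> E" and s: "s \<in> S"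
    consider "v \<notin> H b" | "v \<in> H b" "v \<notin> Y" | "v \<in> Y" by blast
    then show "v + s \<in> E"
    proof cases
      case 1
      then show ?thesis using s v by (simp add: S_def)
    next
      case 2
      then show ?thesis using Y_outside v s SY by blast
    qed (use Y_blue v in blast)
  qed
  then have "S = {0}" using bS b' by blast
  then have "a = 0 \<or> a = b"
    using A_S[OF a] by (auto simp: f2_add_eq_0_iff)
  then show False
    using a b' zero_E by (auto simp: A_def mixed_def)
qed

lemma mixed_iff: "centre b \<Longrightarrow> v \<in> V \<Longrightarrow> v \<in> mixed b \<longleftrightarrow> v \<notin> H b"
  using inside_not_mixed outside_mixed by blast

text \<open>Nonzero vectors of blue type relative to a centre are centres, so the span contains
  \<open>H b\<close> and \<open>H u\<close>. These are different hyperplanes and together generate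
  \<open>V\<close>.\<close>

lemma span_centres:
  assumes b: "centre b"
  shows "V \<subseteq> f2.span {b. centre b}"
proof -
  have sub: "H c \<subseteq> f2.span {b. centre b}" if c: "centre c" for c
  proof -
    have "x \<in> f2.span {b. centre b}" if "x \<in> blues c" for x
      using centre_blues(1)[OF c that] c by (cases "x = 0 \<or> x = c") (auto intro: f2.span_base f2.span_zero)
    then show ?thesis
      by (intro f2.span_minimal) auto
  qed
  obtain u where u: "u \<in> blues b" "u \<noteq> 0" "u \<noteq> b"
    using b by (auto simp: centre_def)
  have cu: "centre u" "b \<in> blues u" using centre_blues[OF b u] by blast+
  have "\<not> H u \<subseteq> H b"
    using H_not_sub[OF cu] b u by (auto simp: centre_def)
  then obtain v where "v \<in> H u" "v \<notin> H b" by blast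
  then show ?thesis
    using H_maximal[OF b f2.subspace_span sub[OF b], of v] sub[OF cu(1)] H_sub by blast
qed

definition ind :: "'a \<Rightarrow> bit" where
  "ind x = of_bool (x \<in> E)"

text \<open>The sum is the third difference of \<open>ind\<close> at 0, where
  \<open>ind 0 = 0\<close>. It vanishes when one direction is a centre \<open>b\<close>, because the
  derivative along \<open>b\<close> is the linear form with kernel \<open>H b\<close>; the centres
  span \<open>V\<close>.\<close>

lemma third_difference:
  assumes c: "centre c" and x: "x \<in> V" "y \<in> V" "z \<in> V"
  shows "ind x + ind y + ind z + ind (x + y) + ind (x + z) + ind (y + z) + ind (x + y + z) = 0"
proof -
  define P where "P u x y = ind x + ind y + ind u + ind (x + y) + ind (x + u) + ind (y + u) + ind (x + y + u)"
    for u x y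
  define Q where "Q = {u \<in> V. \<forall>x\<in>V. \<forall>y\<in>V. P u x y = 0}"
  have ind0: "ind 0 = 0"
    using zero_E by (simp add: ind_def)
  \<comment> \<open>A cocycle identity for the third difference. It makes the set of directions
    \<open>u\<close> in which \<open>P\<close> vanishes for all arguments closed under
    addition.\<close>
  have P_add: "P (u + u') x y = P u x (y + u') + P u x u' + P u' x y" for u u' x y
    unfolding P_def by (simp only: f2_ac)
  have P_zero: "P 0 x y = 0" for x y
    unfolding P_def by (simp only: ind0 f2_ac)
  have "f2.subspace Q"
  proof (rule f2_subspaceI)
    show "0 \<in> Q"
      using V_zero by (simp add: Q_def P_zero)
    fix u u'
    assume "u \<in> Q" "u' \<in> Q"
    then show "u + u' \<in> Q"
      using V_add by (simp add: Q_def P_add)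
  qed
  moreover have "{b. centre b} \<subseteq> Q"
  proof
    fix b
    assume "b \<in> {b. centre b}"
    then have b: "centre b" "b \<in> V" "ind b = 0"
      using centre_dest by (auto simp: ind_def)
    have diff: "ind (x + b) = ind x + of_bool (x \<notin> H b)" if "x \<in> V" for x
      using mixed_iff[OF b(1) that] that by (auto simp: ind_def mixed_def)
    have "P b x y = 0" if "x \<in> V" "y \<in> V" for x y
    proof -
      have "P b x y = of_bool (x \<notin> H b) + of_bool (y \<notin> H b) + of_bool (x + y \<notin> H b)"
        unfolding P_def b(3) diff[OF that(1)] diff[OF that(2)] diff[OF V_add[OF that]]
        by (simp only: f2_ac)
      also have "\<dots> = 0"
        using H_add_iff[OF b(1) that] by auto
      finally show ?thesis .
    qed
    then show "b \<in> Q"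
      using b(2) by (simp add: Q_def)
  qed
  ultimately have "V \<subseteq> Q"
    using span_centres[OF c] f2.span_minimal[of "{b. centre b}" Q] by blast
  then have "P z x y = 0"
    using x by (auto simp: Q_def)
  then show ?thesis
    by (simp only: P_def f2_ac)
qed

end

section \<open>The three kinds of prime claw-free sets\<close>

context prime_claw_free_set
begin

theorem prime_claw_free_cases:
  obtains L1 L2 where "f2.subspace L1" "f2.subspace L2" "L1 \<subseteq> V" "L2 \<subseteq> V" "L1 \<inter> L2 = {0}"
    "E = L1 \<union> L2 - {0}"
  | "\<And>x y z. x \<in> V \<Longrightarrow> y \<in> V \<Longrightarrow> z \<in> V \<Longrightarrow> of_bool (x \<in> E) + of_bool (y \<in> E) + of_bool (z \<in> E)
      + of_bool (x + y \<in> E) + of_bool (x + z \<in> E) + of_bool (y + z \<in> E) + of_bool (x + y + z \<in> E)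
      = (0 :: bit)"
  | "\<And>x y. x \<in> V - E \<Longrightarrow> y \<in> V - E \<Longrightarrow> x \<noteq> 0 \<Longrightarrow> y \<noteq> 0 \<Longrightarrow> x \<noteq> y \<Longrightarrow> x + y \<in> E"
proof (cases "\<exists>b. centre b")
  case True
  then obtain c where c: "centre c" by blast
  show thesis
  proof (cases "\<exists>b. centre b \<and> f2.span (blues b) = V")
    case True
    then show thesis
      using PG_sum_if_span_blues that(1) by (metis centre_def)
  next
    case False
    then interpret non_PG_sum_set V E
      by unfold_locales auto
    show thesis
      using third_difference[OF c] that(2) by (simp add: ind_def)
  qed
next
  case False
  show thesis
  proof (rule that(3))
    fix x y
    assume xy: "x \<in> V - E" "y \<in> V - E" "x \<noteq> 0" "y \<noteq> 0" "x \<noteq> y"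
    then have "y \<notin> blues x"
      using False by (auto simp: centre_def)
    then show "x + y \<in> E"
      using xy by (simp add: blues_def add.commute)
  qed
qed

end

section \<open>Matroids\<close>

lemma finite_span_f2:
  assumes "finite (B :: 'a::f2_vector set)"
  shows "finite (f2.span B)"
  using assms
proof (induction B)
  case (insert b B)
  have "f2.span (insert b B) \<subseteq> {w. w \<in> f2.span B \<or> w + b \<in> f2.span B}"
    by (intro f2.span_minimal f2_subspace_add_point f2.subspace_span)
      (auto intro: f2.span_base f2.span_zero)
  also have "\<dots> \<subseteq> f2.span B \<union> (\<lambda>w. w + b) ` f2.span B"
    by (force simp: f2_ac)
  finally show ?case
    using insert.IH by (meson finite_UnI finite_imageI finite_subset)
qed simp

lemma matroid_iff:
  "matroid (E, G) \<longleftrightarrow> 0 \<notin> G \<and> f2.subspace (vecs G) \<and> finite G \<and> E \<subseteq> (G :: 'a::f2_vector set)"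
proof -
  have "finite G" if "finite B" "f2.span B = vecs G" for B
    using finite_span_f2[OF that(1)] that(2) by (simp add: vecs_def)
  moreover have "\<exists>B. finite B \<and> f2.span B = vecs G" if "finite G" "f2.subspace (vecs G)"
    using that f2.span_eq_iff[of "vecs G"] by (intro exI[of _ "vecs G"]) (simp add: vecs_def)
  ultimately show ?thesis
    by (auto simp: matroid_def)
qed

lemma span_two: "f2.span {x, y} = {0, x, y, x + y :: 'a::f2_vector}"
proof
  have "f2.subspace {0, x, y, x + y}"
    by (rule f2_subspaceI) (auto simp: f2_ac)
  then show "f2.span {x, y} \<subseteq> {0, x, y, x + y}"
    by (intro f2.span_minimal) auto
qed (auto intro: f2.span_base f2.span_zero f2.span_add)

lemma span_three:
  "f2.span {x, y, z} = {0, x, y, z, x + y, x + z, y + z, x + y + z :: 'a::f2_vector}"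
proof
  have "f2.subspace {0, x, y, z, x + y, x + z, y + z, x + y + z}"
    by (rule f2_subspaceI) (auto simp: f2_ac)
  then show "f2.span {x, y, z} \<subseteq> {0, x, y, z, x + y, x + z, y + z, x + y + z}"
    by (intro f2.span_minimal) auto
  have "x \<in> f2.span {x, y, z}" "y \<in> f2.span {x, y, z}" "z \<in> f2.span {x, y, z}"
    by (simp_all add: f2.span_base)
  then show "{0, x, y, z, x + y, x + z, y + z, x + y + z} \<subseteq> f2.span {x, y, z}"
    by (simp add: f2.span_zero f2.span_add)
qed

lemma independent_two:
  "x \<noteq> 0 \<Longrightarrow> y \<noteq> 0 \<Longrightarrow> x \<noteq> y \<Longrightarrow> f2.independent {x, y :: 'a::f2_vector}"
  using span_two[of y y] by (simp add: f2.independent_insert)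

lemma independent_three:
  assumes "0 \<notin> {x, y, z, x + y, x + z, y + z, x + y + z :: 'a::f2_vector}"
  shows "f2.independent {x, y, z}" "card {x, y, z} = 3"
proof -
  have "x \<noteq> 0" "y \<noteq> 0" "z \<noteq> 0" and ne: "x \<noteq> y" "x \<noteq> z" "y \<noteq> z" and "x \<noteq> y + z"
    using assms by (auto simp: add.assoc)
  then have "x \<notin> f2.span {y, z}"
    by (simp add: span_two)
  then show "f2.independent {x, y, z}"
    using independent_two[OF \<open>y \<noteq> 0\<close> \<open>z \<noteq> 0\<close> \<open>y \<noteq> z\<close>] ne by (simp add: f2.independent_insert)
  show "card {x, y, z} = 3"
    using ne by simp
qed

lemma independent_threeD:
  assumes ind: "f2.independent {x, y, z :: 'a::f2_vector}" and "card {x, y, z} = 3"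
  shows "0 \<notin> {x, y, z, x + y, x + z, y + z, x + y + z}"
proof -
  have "x \<noteq> y" "x \<noteq> z" "y \<noteq> z"
    using assms(2) by (auto simp: card_insert_if split: if_splits)
  moreover from this have "x \<notin> f2.span {y, z}"
    using ind by (simp add: f2.independent_insert)
  then have "x \<noteq> y + z"
    by (simp add: span_two)
  moreover have "x \<noteq> 0" "y \<noteq> 0" "z \<noteq> 0"
    using ind f2.dependent_zero[of "{x, y, z}"] by auto
  ultimately have "x + y \<noteq> 0" "x + z \<noteq> 0" "y + z \<noteq> 0" "x + (y + z) \<noteq> 0"
    unfolding f2_add_eq_0_iff by blast+
  then show ?thesis
    using \<open>x \<noteq> 0\<close> \<open>y \<noteq> 0\<close> \<open>z \<noteq> 0\<close> by (simp add: add.assoc)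
qed

lemma sums_not_in_basis:
  fixes p q r :: "'a::f2_vector"
  assumes "0 \<notin> {p, q, r, p + q, p + r, q + r, p + q + r}"
  shows "p + q \<notin> {p, q, r}" "p + r \<notin> {p, q, r}" "q + r \<notin> {p, q, r}" "p + q + r \<notin> {p, q, r}"
proof -
  have ne: "a \<noteq> 0" if "a \<in> {p, q, r, p + q, p + r, q + r, p + q + r}" for a
    using assms that by metis
  have nz: "p \<noteq> 0" "q \<noteq> 0" "r \<noteq> 0" "p + q \<noteq> 0" "p + r \<noteq> 0" "q + r \<noteq> 0" "p + q + r \<noteq> 0"
    by (rule ne, simp)+
  have sum: "p + q + r = q + (p + r)" "p + q + r = r + (p + q)"
    by (simp_all only: add_ac)
  have ne: "p \<noteq> q + r" "q \<noteq> p + r" "r \<noteq> p + q"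
    subgoal using nz(7) by (auto simp: add.assoc)
    subgoal using nz(7) unfolding sum(1) by auto
    subgoal using nz(7) unfolding sum(2) by auto
    done
  show "p + q \<notin> {p, q, r}" "p + r \<notin> {p, q, r}" "q + r \<notin> {p, q, r}"
    using nz(1-3) ne by auto
  have "p + q + r \<noteq> p"
    using nz(6) by (simp add: add.assoc)
  moreover have "p + q + r \<noteq> q"
    unfolding sum(1) using nz(5) by simp
  moreover have "p + q + r \<noteq> r"
    using nz(4) by simp
  ultimately show "p + q + r \<notin> {p, q, r}"
    by blast
qed

lemma dim_two:
  assumes "f2.subspace (S :: 'a::f2_vector set)" "f2.dim S = 2"
  obtains x y where "x \<noteq> 0" "y \<noteq> 0" "x \<noteq> y" "S = {0, x, y, x + y}"
proof -
  obtain B where B: "B \<subseteq> S" "f2.independent B" "S \<subseteq> f2.span B" "card B = 2"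
    using f2.basis_exists[of S] assms(2) by metis
  then obtain x y where xy: "B = {x, y}" "x \<noteq> y"
    by (auto simp: card_2_iff)
  moreover have "S = f2.span B"
    using B(1,3) f2.span_minimal[OF _ assms(1)] by blast
  ultimately show ?thesis
    using that[of x y] B(2) f2.dependent_zero by (auto simp: span_two)
qed

lemma dim_three:
  assumes "f2.subspace (S :: 'a::f2_vector set)" "f2.dim S = 3"
  obtains x y z where "0 \<notin> {x, y, z, x + y, x + z, y + z, x + y + z}"
    "S = {0, x, y, z, x + y, x + z, y + z, x + y + z}"
proof -
  obtain B where B: "B \<subseteq> S" "f2.independent B" "S \<subseteq> f2.span B" "card B = 3"
    using f2.basis_exists[of S] assms(2) by metis
  then obtain x y z where xyz: "B = {x, y, z}"
    by (auto simp: card_3_iff)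
  moreover have "S = f2.span B"
    using B(1,3) f2.span_minimal[OF _ assms(1)] by blast
  ultimately show ?thesis
    using that[of x y z] independent_threeD[of x y z] B(2,4) by (simp add: span_three)
qed

section \<open>Coordinates and isomorphisms\<close>

lemma embed_f2_seq:
  fixes V :: "'a::f2_vector set"
  assumes V: "finite V" "f2.subspace V"
  obtains g :: "'a \<Rightarrow> f2_seq" where "inj_on g V" "\<forall>x\<in>V. \<forall>y\<in>V. g (x + y) = g x + g y"
proof -
  obtain B where B: "B \<subseteq> V" "f2.independent B" "V \<subseteq> f2.span B"
    using f2.basis_exists[of V] by metis
  then have "finite B"
    using V(1) finite_subset by blast
  then obtain h :: "'a \<Rightarrow> nat" where h: "inj_on h B"
    using finite_imp_inj_to_nat_seg by blast
  \<comment> \<open>The inverse of the enumeration \<open>h\<close> of the basis. Its unspecified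
    values outside the range of \<open>h\<close> disturb neither additivity nor injectivity of
    \<open>g\<close>.\<close>
  define c where "c = inv_into B h"
  have c: "c (h b) = b" if "b \<in> B" for b
    using h that by (simp add: c_def)
  define g where "g v = (\<lambda>i. f2.representation B v (c i))" for v
  have "inj_on g V"
  proof (rule inj_onI)
    fix v w
    assume vw: "v \<in> V" "w \<in> V" "g v = g w"
    have "f2.representation B v b = f2.representation B w b" for b
    proof (cases "b \<in> B")
      case True
      then show ?thesis
        using fun_cong[OF vw(3), of "h b"] c by (simp add: g_def)
    next
      case False
      then show ?thesis
        using f2.representation_ne_zero by metis
    qed
    then have "f2.representation B v = f2.representation B w"
      by blast
    then show "v = w"
      using f2.sum_nonzero_representation_eq[OF B(2)] vw B(3) by (metis subsetD)
  qed
  moreover have "g (x + y) = g x + g y" if "x \<in> V" "y \<in> V" for x y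
    using that B by (auto simp: g_def fun_eq_iff f2.representation_add subset_iff)
  ultimately show ?thesis
    using that[of g] by blast
qed

lemma additive_zero:
  assumes "0 \<in> A" "\<And>x y. x \<in> A \<Longrightarrow> y \<in> A \<Longrightarrow> f (x + y) = f x + f y"
  shows "f (0 :: 'a::f2_vector) = (0 :: 'b::f2_vector)"
  using assms(2)[OF assms(1,1)] by simp

lemma vecs_zero [simp]: "0 \<in> vecs G"
  by (simp add: vecs_def)

lemma vecs_Diff: "0 \<in> S \<Longrightarrow> vecs (S - {0}) = S"
  by (auto simp: vecs_def)

lemma matroid_vecs_add: "matroid (E, G) \<Longrightarrow> x \<in> vecs G \<Longrightarrow> y \<in> vecs G \<Longrightarrow> x + y \<in> vecs G"
  by (simp add: matroid_iff f2_subspace_iff)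

lemma matroid_isoI:
  assumes "bij_betw f (vecs G1) (vecs G2)" "f ` E1 = E2"
    and add: "\<And>x y. x \<in> vecs G1 \<Longrightarrow> y \<in> vecs G1 \<Longrightarrow> f (x + y) = f x + f y"
  shows "(E1, G1) \<simeq> (E2, G2)"
proof -
  have "f (scale2 a x) = scale2 a (f x)" if "x \<in> vecs G1" for a x
    using additive_zero[of "vecs G1" f] add by (cases a) (simp_all add: scale2_one)
  then show ?thesis
    using assms by (auto simp: matroid_iso_def)
qed

lemma matroid_isoE:
  assumes "(E1, G1) \<simeq> (E2, G2)"
  obtains f where "bij_betw f (vecs G1) (vecs G2)" "f ` E1 = E2"
    "\<forall>x\<in>vecs G1. \<forall>y\<in>vecs G1. f (x + y) = f x + f y"
  using assms by (auto simp: matroid_iso_def)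

lemma matroid_iso_sym:
  assumes M: "matroid M" and iso: "M \<simeq> N"
  shows "N \<simeq> M"
proof -
  obtain E1 G1 E2 G2 where eq: "M = (E1, G1)" "N = (E2, G2)" by fastforce
  obtain f where f: "bij_betw f (vecs G1) (vecs G2)" "f ` E1 = E2"
    "\<forall>x\<in>vecs G1. \<forall>y\<in>vecs G1. f (x + y) = f x + f y"
    using iso unfolding eq by (rule matroid_isoE)
  define g where "g = inv_into (vecs G1) f"
  have g: "bij_betw g (vecs G2) (vecs G1)"
    unfolding g_def using f(1) by (rule bij_betw_inv_into)
  have gf: "g (f x) = x" if "x \<in> vecs G1" for x
    unfolding g_def using f(1) that by (rule bij_betw_inv_into_left)
  have fg: "f (g y) = y" if "y \<in> vecs G2" for y
    unfolding g_def using f(1) that by (rule bij_betw_inv_into_right)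
  have E1: "E1 \<subseteq> vecs G1"
    using M by (auto simp: eq matroid_iff vecs_def)
  show ?thesis
    unfolding eq
  proof (rule matroid_isoI[OF g])
    show "g ` E2 = E1"
      using E1 gf by (force simp: f(2)[symmetric] image_image)
    fix x y
    assume "x \<in> vecs G2" "y \<in> vecs G2"
    then have "g x \<in> vecs G1" "g y \<in> vecs G1" "x + y = f (g x + g y)"
      using g f(3) fg by (auto simp: bij_betw_apply)
    then show "g (x + y) = g x + g y"
      using gf matroid_vecs_add M eq by metis
  qed
qed

lemma matroid_iso_trans:
  assumes "M \<simeq> N" "N \<simeq> K"
  shows "M \<simeq> K"
proof -
  obtain E1 G1 E2 G2 E3 G3 where eq: "M = (E1, G1)" "N = (E2, G2)" "K = (E3, G3)" by fastforce
  obtain f where f: "bij_betw f (vecs G1) (vecs G2)" "f ` E1 = E2"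
    "\<forall>x\<in>vecs G1. \<forall>y\<in>vecs G1. f (x + y) = f x + f y"
    using assms(1) unfolding eq by (rule matroid_isoE)
  obtain g where g: "bij_betw g (vecs G2) (vecs G3)" "g ` E2 = E3"
    "\<forall>x\<in>vecs G2. \<forall>y\<in>vecs G2. g (x + y) = g x + g y"
    using assms(2) unfolding eq by (rule matroid_isoE)
  show ?thesis
    unfolding eq
  proof (rule matroid_isoI)
    show "bij_betw (g \<circ> f) (vecs G1) (vecs G3)"
      using f(1) g(1) by (rule bij_betw_trans)
    show "(g \<circ> f) ` E1 = E3"
      using f(2) g(2) by (simp only: image_comp[symmetric])
  qed (use f g bij_betw_apply[OF f(1)] in auto)
qed

lemma matroid_image:
  fixes f :: "'a::f2_vector \<Rightarrow> 'b::f2_vector"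
  assumes M: "matroid (E, G)" and inj: "inj_on f (vecs G)"
    and add: "\<And>x y. x \<in> vecs G \<Longrightarrow> y \<in> vecs G \<Longrightarrow> f (x + y) = f x + f y"
  shows "matroid (f ` E, f ` G)" "(E, G) \<simeq> (f ` E, f ` G)"
proof -
  have f0: "f 0 = 0"
    by (rule additive_zero[of "vecs G"]) (use add in auto)
  then have vecs: "vecs (f ` G) = f ` vecs G"
    by (simp add: vecs_def)
  have "f2.subspace (f ` vecs G)"
  proof (rule f2_subspaceI)
    show "0 \<in> f ` vecs G"
      using f0 vecs_zero by (metis imageI)
    fix x y
    assume "x \<in> f ` vecs G" "y \<in> f ` vecs G"
    then obtain u v where "u \<in> vecs G" "v \<in> vecs G" "x = f u" "y = f v"
      by blast
    then have "x + y = f (u + v)" "u + v \<in> vecs G"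
      using add matroid_vecs_add[OF M] by simp_all
    then show "x + y \<in> f ` vecs G" by blast
  qed
  moreover have "0 \<notin> f ` G"
    using inj f0 M by (auto simp: vecs_def matroid_iff inj_on_def)
  ultimately show "matroid (f ` E, f ` G)"
    using M by (auto simp: matroid_iff vecs)
  show "(E, G) \<simeq> (f ` E, f ` G)"
    by (rule matroid_isoI[of f]) (use inj add in \<open>auto simp: bij_betw_def vecs\<close>)
qed

lemma iso_f2_seq:
  fixes M :: "'a::f2_vector matroid"
  assumes "matroid M"
  obtains N :: "f2_seq matroid" where "matroid N" "M \<simeq> N"
proof -
  obtain E G where M: "M = (E, G)" by fastforce
  have "finite (vecs G)" "f2.subspace (vecs G)"
    using assms by (simp_all add: M matroid_iff vecs_def)
  then obtain g :: "'a \<Rightarrow> f2_seq" where "inj_on g (vecs G)"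
    "\<forall>x\<in>vecs G. \<forall>y\<in>vecs G. g (x + y) = g x + g y"
    by (rule embed_f2_seq)
  then show ?thesis
    using matroid_image[of E G g] assms that by (simp add: M)
qed

text \<open>This trades flats and isomorphisms for a condition on sums. Three red vectors with four
  blue sums are independent because 0 is not red, so they span a claw; conversely the basis of a
  claw pulls back to such a triple.\<close>

lemma claw_free_iff:
  fixes E :: "'a::f2_vector set"
  assumes M: "matroid (E, G)"
  shows "claw_free (E, G) \<longleftrightarrow>
    (\<forall>x\<in>E. \<forall>y\<in>E. \<forall>z\<in>E. x + y \<notin> E \<longrightarrow> x + z \<notin> E \<longrightarrow> y + z \<notin> E \<longrightarrow> x + y + z \<in> E)"
proof
  assume free: "claw_free (E, G)"
  show "\<forall>x\<in>E. \<forall>y\<in>E. \<forall>z\<in>E. x + y \<notin> E \<longrightarrow> x + z \<notin> E \<longrightarrow> y + z \<notin> E \<longrightarrow> x + y + z \<in> E"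
  proof (intro ballI impI, rule ccontr)
    fix x y z
    assume xyz: "x \<in> E" "y \<in> E" "z \<in> E" and nE: "x + y \<notin> E" "x + z \<notin> E" "y + z \<notin> E" "x + y + z \<notin> E"
    have 0: "0 \<notin> E" using M by (auto simp: matroid_iff)
    have ne: "0 \<notin> {x, y, z, x + y, x + z, y + z, x + y + z}"
      using xyz nE 0 by (auto simp: f2_add_eq_0_iff f2_ac)
    define F where "F = {x, y, z, x + y, x + z, y + z, x + y + z}"
    have span: "vecs F = f2.span {x, y, z}"
      by (simp add: F_def vecs_def span_three)
    have F: "flat G F"
      unfolding flat_def
    proof
      have "vecs F \<subseteq> vecs G"
        unfolding span using M xyz by (intro f2.span_minimal) (auto simp: matroid_iff vecs_def)
      moreover have "0 \<notin> F"
        using ne by (simp only: F_def not_False_eq_True)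
      ultimately show "F \<subseteq> G"
        by (auto simp: vecs_def)
    qed (simp add: span)
    have EF: "E \<inter> F = {x, y, z}"
      using xyz nE by (auto simp: F_def)
    have mF: "matroid ({x, y, z}, F)"
      using ne unfolding matroid_iff span by (auto simp: F_def)
    \<comment> \<open>Claw-freeness quantifies over claws in \<open>f2_seq\<close> only, so the
      restriction to \<open>F\<close> is first copied there.\<close>
    obtain N :: "f2_seq matroid" where N: "matroid N" "({x, y, z}, F) \<simeq> N"
      using iso_f2_seq[OF mF] .
    obtain E' G' where N': "N = (E', G')" by fastforce
    obtain f where f: "bij_betw f (vecs F) (vecs G')" "f ` {x, y, z} = E'"
      "\<forall>x\<in>vecs F. \<forall>y\<in>vecs F. f (x + y) = f x + f y"
      using N(2) unfolding N' by (rule matroid_isoE)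
    have f0: "f 0 = 0"
      by (rule additive_zero[of "vecs F"]) (use f(3) in auto)
    have fF: "f u \<noteq> 0" if "u \<in> F" for u
    proof
      assume "f u = 0"
      then have "u = 0"
        using f(1) f0 that by (auto simp: bij_betw_def inj_on_def vecs_def)
      then show False
        using that ne by (simp add: F_def)
    qed
    have inF: "x \<in> vecs F" "y \<in> vecs F" "z \<in> vecs F" "x + y \<in> vecs F"
      by (simp_all add: F_def vecs_def)
    have fsum: "f (x + y) = f x + f y" "f (x + z) = f x + f z" "f (y + z) = f y + f z"
      "f (x + y + z) = f x + f y + f z"
      using inF f(3)[rule_format] by (simp_all only:)
    have ne': "0 \<notin> {f x, f y, f z, f x + f y, f x + f z, f y + f z, f x + f y + f z}"
      using fF[of x] fF[of y] fF[of z] fF[of "x + y"] fF[of "x + z"] fF[of "y + z"] fF[of "x + y + z"]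
      by (simp add: fsum F_def)
    have "vecs G' = f ` vecs F"
      using f(1) by (simp add: bij_betw_def)
    then have span': "vecs G' = f2.span {f x, f y, f z}"
      by (simp add: vecs_def F_def fsum f0 span_three)
    have "claw N"
      using N(1) independent_three[OF ne'] f(2) span' f2.dim_eq_card_independent[of "{f x, f y, f z}"]
      by (simp add: claw_def N' flat_dim_def f2.dim_span)
    moreover have "induced_restriction (E, G) F \<simeq> N"
      using N(2) by (simp add: induced_restriction_def EF)
    moreover have "flat (snd (E, G)) F"
      using F by simp
    ultimately show False
      using free unfolding claw_free_def free_of_def by blast
  qed
next
  assume free: "\<forall>x\<in>E. \<forall>y\<in>E. \<forall>z\<in>E. x + y \<notin> E \<longrightarrow> x + z \<notin> E \<longrightarrow> y + z \<notin> E \<longrightarrow> x + y + z \<in> E"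
  show "claw_free (E, G)"
    unfolding claw_free_def free_of_def
  proof (intro allI impI notI, elim exE conjE)
    fix N :: "f2_seq matroid" and F
    assume N: "claw N" and F: "flat (snd (E, G)) F" and iso: "induced_restriction (E, G) F \<simeq> N"
    obtain B G' where N': "N = (B, G')" by fastforce
    have ind: "f2.independent B" and "f2.span B = vecs G'" "f2.dim (vecs G') = 3"
      using N by (simp_all add: claw_def N' flat_dim_def)
    then have "card B = 3"
      using f2.dim_eq_card_independent[OF ind] f2.dim_span[of B] by simp
    then obtain p q r where B: "B = {p, q, r}"
      by (auto simp: card_3_iff)
    have ne: "0 \<notin> {p, q, r, p + q, p + r, q + r, p + q + r}"
      using independent_threeD[of p q r] ind \<open>card B = 3\<close> B by simp
    obtain f where f: "bij_betw f (vecs F) (vecs G')" "f ` (E \<inter> F) = B"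
      "\<forall>x\<in>vecs F. \<forall>y\<in>vecs F. f (x + y) = f x + f y"
      using iso unfolding N' induced_restriction_def fst_conv by (rule matroid_isoE)
    have "p \<in> f ` (E \<inter> F)" "q \<in> f ` (E \<inter> F)" "r \<in> f ` (E \<inter> F)"
      by (simp_all add: f(2) B)
    then obtain x y z where xyz: "x \<in> E \<inter> F" "y \<in> E \<inter> F" "z \<in> E \<inter> F" "f x = p" "f y = q" "f z = r"
      by blast
    have V: "x \<in> vecs F" "y \<in> vecs F" "z \<in> vecs F"
      using xyz by (auto simp: vecs_def)
    have "f2.subspace (vecs F)"
      using F by (simp add: flat_def)
    then have V': "x + y \<in> vecs F" "x + z \<in> vecs F" "y + z \<in> vecs F" "x + y + z \<in> vecs F"
      using V by (simp_all add: f2_subspace_iff)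
    have "0 \<notin> E" using M by (auto simp: matroid_iff)
    then have notE: "u \<notin> E" if "u \<in> vecs F" "f u \<notin> B" for u
      using that imageI[of u "E \<inter> F" f] unfolding f(2) by (auto simp: vecs_def)
    note notB = sums_not_in_basis[OF ne, folded B]
    have "f (x + y) = p + q" "f (x + z) = p + r" "f (y + z) = q + r" "f (x + y + z) = p + q + r"
      using f(3)[rule_format] V V' xyz(4-6) by (simp_all only:)
    then have "x + y \<notin> E" "x + z \<notin> E" "y + z \<notin> E" "x + y + z \<notin> E"
      using notE[OF V'(1)] notE[OF V'(2)] notE[OF V'(3)] notE[OF V'(4)] notB by simp_all
    then show False
      using free xyz(1-3) by blast
  qed
qed

section \<open>Basic matroids are claw-free\<close>

lemma claw_nonzero:
  assumes "0 \<notin> E" "x \<in> E" "y \<in> E" "z \<in> E" "x + y \<notin> E" "x + z \<notin> E" "y + z \<notin> E" "x + y + z \<notin> E"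
  shows "0 \<notin> {x, y, z, x + y, x + z, y + z, x + y + z :: 'a::f2_vector}"
  using assms by (auto simp: f2_add_eq_0_iff f2_ac)

lemma vecs_subsetD: "vecs F \<subseteq> vecs G \<Longrightarrow> 0 \<notin> F \<Longrightarrow> F \<subseteq> G"
  by (auto simp: vecs_def)

lemma plane_three:
  assumes ne: "0 \<notin> {x, y, z, x + y, x + z, y + z, x + y + z :: 'a::f2_vector}"
    and G: "f2.subspace (vecs G)" "x \<in> vecs G" "y \<in> vecs G" "z \<in> vecs G"
  shows "plane G {x, y, z, x + y, x + z, y + z, x + y + z}" (is "plane G ?P")
proof -
  have span: "vecs ?P = f2.span {x, y, z}"
    by (simp add: vecs_def span_three)
  have "vecs ?P \<subseteq> vecs G"
    unfolding span using G by (intro f2.span_minimal) auto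
  then have "?P \<subseteq> G"
    using ne by (rule vecs_subsetD)
  then show ?thesis
    unfolding plane_def flat_def flat_dim_def span
    using independent_three[OF ne] f2.dim_eq_card_independent[of "{x, y, z}"] by (simp add: f2.dim_span)
qed

lemma triangle_two:
  assumes ne: "x \<noteq> 0" "y \<noteq> 0" "x \<noteq> (y :: 'a::f2_vector)"
    and G: "f2.subspace (vecs G)" "x \<in> vecs G" "y \<in> vecs G"
  shows "triangle G {x, y, x + y}"
proof -
  have span: "vecs {x, y, x + y} = f2.span {x, y}"
    by (simp add: vecs_def span_two)
  have "vecs {x, y, x + y} \<subseteq> vecs G"
    unfolding span using G by (intro f2.span_minimal) auto
  then have "{x, y, x + y} \<subseteq> G"
    using ne by (auto simp: vecs_def f2_add_eq_0_iff)
  then show ?thesis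
    unfolding triangle_def flat_def flat_dim_def span
    using independent_two[OF ne] ne f2.dim_eq_card_independent[of "{x, y}"] by (simp add: f2.dim_span)
qed

lemma flat_add: "flat G F \<Longrightarrow> x \<in> F \<Longrightarrow> y \<in> F \<Longrightarrow> x + y \<noteq> 0 \<Longrightarrow> x + y \<in> F"
  by (auto simp: flat_def f2_subspace_iff vecs_def)

text \<open>Consider a claw \<open>x\<close>, \<open>y\<close>, \<open>z\<close>. In a PG-sum two of
  its vectors share a flat, so their sum is red; its plane contains exactly three red vectors; and
  its three pair sums form a triangle in the complement.\<close>

lemma basic_claw_free:
  assumes "basic_matroid M"
  shows "claw_free M"
proof -
  obtain E G where M: "M = (E, G)" by fastforce
  have mat: "matroid (E, G)"
    using assms by (simp add: basic_matroid_def M)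
  then have E: "0 \<notin> E" "E \<subseteq> vecs G" and sub: "f2.subspace (vecs G)"
    by (auto simp: matroid_iff vecs_def)
  have False
    if xyz: "x \<in> E" "y \<in> E" "z \<in> E" "x + y \<notin> E" "x + z \<notin> E" "y + z \<notin> E" "x + y + z \<notin> E" for x y z
  proof -
    have ne: "0 \<notin> {x, y, z, x + y, x + z, y + z, x + y + z}"
      using claw_nonzero[OF E(1) xyz] .
    have ne2: "x + y \<noteq> 0" "x + z \<noteq> 0" "y + z \<noteq> 0"
      using E(1) xyz by (auto simp: f2_add_eq_0_iff f2_ac)
    have V: "x \<in> vecs G" "y \<in> vecs G" "z \<in> vecs G"
      using xyz E by blast+
    consider "PG_sum (E, G)" | "even_plane (E, G)"
      | N where "matroid N" "triangle_free N" "(E, G) = complement N"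
      using assms by (auto simp: basic_matroid_def M)
    then show False
    proof cases
      case 1
      then obtain F1 F2 where "flat G F1" "flat G F2" "E = F1 \<union> F2"
        by (auto simp: PG_sum_def)
      then show False
        using xyz(1-6) ne2 flat_add by (metis Un_iff)
    next
      case 2
      define P where "P = {x, y, z, x + y, x + z, y + z, x + y + z}"
      have "even (card (E \<inter> P))"
        using 2 plane_three[OF ne sub V] by (simp add: even_plane_def P_def)
      moreover have "E \<inter> P = {x, y, z}"
        using xyz by (auto simp: P_def)
      ultimately show False
        using independent_three(2)[OF ne] by simp
    next
      case 3
      then obtain E' where N: "N = (E', G)" "E = G - E'" and free: "triangle_free (E', G)"
        by (cases N) (auto simp: complement_def)
      have sum: "(x + y) + (x + z) = y + z"
        by (simp only: f2_ac)
      have "triangle G {x + y, x + z, (x + y) + (x + z)}"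
        using ne2 sub V xyz(2,3) sum by (intro triangle_two) (auto simp: f2_subspace_iff)
      moreover have "{x + y, x + z, (x + y) + (x + z)} \<subseteq> E'"
        using calculation xyz(4-6) N(2) unfolding sum triangle_def flat_def by blast
      ultimately show False
        using free by (auto simp: triangle_free_def)
    qed
  qed
  then show ?thesis
    unfolding M claw_free_iff[OF mat] by blast
qed

lemma claw_free_iso:
  assumes mat: "matroid M" "matroid N" and iso: "M \<simeq> N" and free: "claw_free M"
  shows "claw_free N"
proof -
  obtain E1 G1 E2 G2 where eq: "M = (E1, G1)" "N = (E2, G2)" by fastforce
  obtain f where f: "bij_betw f (vecs G1) (vecs G2)" "f ` E1 = E2"
    "\<forall>x\<in>vecs G1. \<forall>y\<in>vecs G1. f (x + y) = f x + f y"
    using iso unfolding eq by (rule matroid_isoE)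
  have E1: "x \<in> vecs G1" if "x \<in> E1" for x
    using mat(1) that by (auto simp: eq matroid_iff vecs_def)
  have img: "f x \<in> E2" if "x \<in> E1" for x
    using f(2) that by blast
  have "x' + y' + z' \<in> E2"
    if xyz': "x' \<in> E2" "y' \<in> E2" "z' \<in> E2" and sums: "x' + y' \<notin> E2" "x' + z' \<notin> E2" "y' + z' \<notin> E2" for x' y' z'
  proof -
    obtain x y z where xyz: "x \<in> E1" "y \<in> E1" "z \<in> E1" "x' = f x" "y' = f y" "z' = f z"
      using xyz' f(2) by blast
    have V: "x \<in> vecs G1" "y \<in> vecs G1" "z \<in> vecs G1" "x + y \<in> vecs G1"
      using xyz E1 matroid_vecs_add[OF mat(1)[unfolded eq]] by simp_all
    have fsum: "f (x + y) = x' + y'" "f (x + z) = x' + z'" "f (y + z) = y' + z'"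
      "f (x + y + z) = x' + y' + z'"
      using f(3)[rule_format] V xyz(4-6) by (simp_all only:)
    then have "x + y \<notin> E1" "x + z \<notin> E1" "y + z \<notin> E1"
      using img[of "x + y"] img[of "x + z"] img[of "y + z"] sums by auto
    then have "x + y + z \<in> E1"
      using free xyz(1-3) unfolding eq(1) claw_free_iff[OF mat(1)[unfolded eq]] by blast
    then show ?thesis
      using img[of "x + y + z"] fsum(4) by simp
  qed
  then show ?thesis
    unfolding eq(2) claw_free_iff[OF mat(2)[unfolded eq]] by blast
qed

section \<open>Lift-joins\<close>

lemma lift_join_eq:
  "lift_join (E1, G1) (E2, G2) =
    (E1 \<times> {0} \<union> vecs G1 \<times> E2, vecs G1 \<times> vecs G2 - {0})"
proof -
  have "(\<lambda>y. (0, y)) ` E2 + (\<lambda>x. (x, 0)) ` vecs G1 = vecs G1 \<times> E2"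
    by (force simp: set_plus_def)
  then show ?thesis
    by (auto simp: lift_join_def)
qed

lemma vecs_lift_join: "vecs (vecs G1 \<times> vecs G2 - {0}) = vecs G1 \<times> vecs G2"
  by (rule vecs_Diff) (simp add: zero_prod_def)

lemma matroid_lift_join:
  assumes "matroid M1" "matroid M2"
  shows "matroid (lift_join M1 M2)"
proof -
  obtain E1 G1 E2 G2 where eq: "M1 = (E1, G1)" "M2 = (E2, G2)" by fastforce
  have "f2.subspace (vecs G1 \<times> vecs G2)"
    using assms by (intro f2_subspaceI) (auto simp: eq zero_prod_def matroid_vecs_add)
  moreover have "finite (vecs G1 \<times> vecs G2)"
    using assms by (simp add: eq matroid_iff vecs_def)
  moreover have "0 \<notin> E1" "0 \<notin> E2" "E1 \<subseteq> vecs G1" "E2 \<subseteq> vecs G2"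
    using assms by (auto simp: eq matroid_iff vecs_def)
  ultimately show ?thesis
    unfolding eq lift_join_eq matroid_iff vecs_lift_join by (auto simp: zero_prod_def)
qed

text \<open>A nonzero second coordinate alone decides the colour. In a claw the second coordinates
  are all 0, giving a claw of \<open>M1\<close>, or all in \<open>E2\<close>, giving one of
  \<open>M2\<close>: a 0 next to an element of \<open>E2\<close> would make a pair sum red.\<close>

lemma claw_free_lift_join:
  assumes mat: "matroid M1" "matroid M2" and free: "claw_free M1" "claw_free M2"
  shows "claw_free (lift_join M1 M2)"
proof -
  obtain E1 G1 E2 G2 where eq: "M1 = (E1, G1)" "M2 = (E2, G2)" by fastforce
  have E1: "E1 \<subseteq> vecs G1" "0 \<notin> E2"
    using mat by (auto simp: eq matroid_iff vecs_def)
  define E where "E = E1 \<times> {0} \<union> vecs G1 \<times> E2"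
  have E_snd: "snd p = 0 \<or> snd p \<in> E2" and E_fst: "fst p \<in> vecs G1" if "p \<in> E" for p
    using that E1 by (auto simp: E_def)
  have lower: "p \<in> E \<longleftrightarrow> fst p \<in> E1" if "snd p = 0" for p
    using that E1 by (cases p) (auto simp: E_def)
  have upper: "p \<in> E" if "snd p \<in> E2" "fst p \<in> vecs G1" for p
    using that by (cases p) (auto simp: E_def)
  have False
    if p: "p \<in> E" "q \<in> E" "r \<in> E" "p + q \<notin> E" "p + r \<notin> E" "q + r \<notin> E" "p + q + r \<notin> E" for p q r
  proof -
    have V: "fst (p + q) \<in> vecs G1" "fst (p + r) \<in> vecs G1" "fst (q + r) \<in> vecs G1" "fst (p + q + r) \<in> vecs G1"
      using E_fst[OF p(1)] E_fst[OF p(2)] E_fst[OF p(3)] matroid_vecs_add[OF mat(1)[unfolded eq]]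
      by simp_all
    have nE2: "snd p + snd q \<notin> E2" "snd p + snd r \<notin> E2" "snd q + snd r \<notin> E2" "snd p + snd q + snd r \<notin> E2"
      using p(4-7) upper[of "p + q"] upper[of "p + r"] upper[of "q + r"] upper[of "p + q + r"] V by auto
    show False
    proof (cases "snd p = 0 \<and> snd q = 0 \<and> snd r = 0")
      case True
      then show False
        using p lower free(1) unfolding eq(1) claw_free_iff[OF mat(1)[unfolded eq]] by auto
    next
      case False
      then have "snd p \<in> E2" "snd q \<in> E2" "snd r \<in> E2"
        using nE2 E_snd[OF p(1)] E_snd[OF p(2)] E_snd[OF p(3)] by auto
      then show False
        using nE2 free(2) unfolding eq(2) claw_free_iff[OF mat(2)[unfolded eq]] by blast
    qed
  qed
  then have "\<forall>p\<in>E. \<forall>q\<in>E. \<forall>r\<in>E. p + q \<notin> E \<longrightarrow> p + r \<notin> E \<longrightarrow> q + r \<notin> E \<longrightarrow> p + q + r \<in> E"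
    by blast
  then show ?thesis
    using claw_free_iff[OF matroid_lift_join[OF mat, unfolded eq lift_join_eq]]
    unfolding eq lift_join_eq E_def by blast
qed

lemma lift_join_cong:
  assumes "M1 \<simeq> N1" "M2 \<simeq> N2" and mat: "matroid M1" "matroid M2"
  shows "lift_join M1 M2 \<simeq> lift_join N1 N2"
proof -
  obtain E1 G1 E2 G2 where eq: "M1 = (E1, G1)" "M2 = (E2, G2)" by fastforce
  obtain E1' G1' E2' G2' where eq': "N1 = (E1', G1')" "N2 = (E2', G2')" by fastforce
  obtain f where f: "bij_betw f (vecs G1) (vecs G1')" "f ` E1 = E1'"
    "\<forall>x\<in>vecs G1. \<forall>y\<in>vecs G1. f (x + y) = f x + f y"
    using assms(1) unfolding eq eq' by (rule matroid_isoE)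
  obtain g where g: "bij_betw g (vecs G2) (vecs G2')" "g ` E2 = E2'"
    "\<forall>x\<in>vecs G2. \<forall>y\<in>vecs G2. g (x + y) = g x + g y"
    using assms(2) unfolding eq eq' by (rule matroid_isoE)
  have "g 0 = 0"
    by (rule additive_zero[of "vecs G2"]) (use g(3) in auto)
  show ?thesis
    unfolding eq eq' lift_join_eq
  proof (rule matroid_isoI[of "map_prod f g"], unfold vecs_lift_join)
    show "bij_betw (map_prod f g) (vecs G1 \<times> vecs G2) (vecs G1' \<times> vecs G2')"
      using f(1) g(1) by (rule bij_betw_map_prod)
    have "f ` vecs G1 = vecs G1'"
      using f(1) by (simp add: bij_betw_def)
    moreover have "map_prod f g ` (A \<times> B) = f ` A \<times> g ` B" for A B
      by force
    ultimately show "map_prod f g ` (E1 \<times> {0} \<union> vecs G1 \<times> E2) = E1' \<times> {0} \<union> vecs G1' \<times> E2'"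
      using \<open>g 0 = 0\<close> f(2) g(2) by (simp only: image_Un image_insert image_empty)
  qed (use f(3) g(3) in auto)
qed

lemma matroid_lift_join_seq:
  assumes "matroid M1" "matroid M2"
  shows "matroid (M1 \<otimes> M2)"
proof -
  obtain E G where eq: "lift_join M1 M2 = (E, G)" by fastforce
  have "matroid (interleave ` E, interleave ` G)"
    using matroid_lift_join[OF assms] bij_interleave unfolding eq
    by (intro matroid_image) (auto simp del: add_Pair simp: interleave_add bij_def intro: inj_on_subset)
  then show ?thesis
    by (simp add: lift_join_seq_def eq)
qed

lemma claw_free_lift_join_seq:
  assumes "matroid M1" "matroid M2" "claw_free M1" "claw_free M2"
  shows "claw_free (M1 \<otimes> M2)"
  using matroid_lift_join[OF assms(1,2)] matroid_lift_join_seq[OF assms(1,2)]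
    lift_join_iso_lift_join_seq claw_free_lift_join[OF assms] by (rule claw_free_iso)

section \<open>Decomposition along a factor\<close>

lemma complement_exists:
  fixes V W :: "'a::f2_vector set"
  assumes V: "finite V" "f2.subspace V" and W: "f2.subspace W" "W \<subseteq> V"
  obtains C where "f2.subspace C" "C \<subseteq> V" "C \<inter> W = {0}" "\<forall>v\<in>V. \<exists>w\<in>W. \<exists>c\<in>C. v = w + c"
proof -
  define \<C> where "\<C> = {C. f2.subspace C \<and> C \<subseteq> V \<and> C \<inter> W = {0}}"
  have "finite \<C>"
    by (rule finite_subset[of _ "Pow V"]) (use V in \<open>auto simp: \<C>_def\<close>)
  moreover have "{0} \<in> \<C>"
    using V W by (auto simp: \<C>_def f2_subspace_iff)
  ultimately obtain C where C: "C \<in> \<C>" and max: "\<And>D. D \<in> \<C> \<Longrightarrow> C \<subseteq> D \<Longrightarrow> C = D"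
    using finite_has_maximal[of \<C>] by blast
  then have C': "f2.subspace C" "C \<subseteq> V" "C \<inter> W = {0}"
    by (auto simp: \<C>_def)
  have "\<exists>w\<in>W. \<exists>c\<in>C. v = w + c" if v: "v \<in> V" for v
  proof (rule ccontr)
    assume no: "\<not> ?thesis"
    \<comment> \<open>The span of \<open>C\<close> and \<open>v\<close>. If \<open>v\<close> is not
      in \<open>W + C\<close>, it still meets \<open>W\<close> trivially, against the maximality of
      \<open>C\<close>.\<close>
    define D where "D = {w. w \<in> C \<or> w + v \<in> C}"
    have "f2.subspace D"
      unfolding D_def using C'(1) by (rule f2_subspace_add_point)
    moreover have "D \<subseteq> V"
    proof
      fix w
      assume "w \<in> D"
      then show "w \<in> V"
        using C'(2) f2_subspace_add_iff(1)[OF V(2) v, of w] by (auto simp: D_def)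
    qed
    moreover have "w + v \<notin> C" if "w \<in> W" for w
    proof
      assume "w + v \<in> C"
      moreover have "v = w + (w + v)" by simp
      ultimately show False
        using no that by blast
    qed
    then have "D \<inter> W = {0}"
      using C'(1,3) by (auto simp: D_def f2_subspace_iff)
    ultimately have "C = D"
      by (intro max) (auto simp: \<C>_def D_def)
    moreover have "v \<in> D"
      using C'(1) by (simp add: D_def f2_subspace_iff)
    ultimately have "v \<in> C" "0 \<in> W" "v = 0 + v"
      using W by (simp_all add: f2_subspace_iff)
    then show False
      using no by blast
  qed
  then have "\<forall>v\<in>V. \<exists>w\<in>W. \<exists>c\<in>C. v = w + c" ..
  with C' show ?thesis
    by (rule that)
qed

text \<open>A complement \<open>C\<close> of \<open>W\<close> meets each coset of \<open>W\<close>
  once, and by \<open>inv\<close> a coset other than \<open>W\<close> has the colour of its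
  representative in \<open>C\<close>. The alternative about \<open>C\<close> ensures that for
  nonzero \<open>W\<close> an induction on the size applies to \<open>C\<close> as well.\<close>

lemma decompose_lift_join:
  fixes E G :: "'a::f2_vector set"
  assumes mat: "matroid (E, G)" and W: "f2.subspace W" "W \<subseteq> vecs G"
    and inv: "\<And>v w. v \<in> vecs G \<Longrightarrow> v \<notin> W \<Longrightarrow> w \<in> W \<Longrightarrow> v \<in> E \<Longrightarrow> v + w \<in> E"
  obtains C where "f2.subspace C" "C \<subseteq> vecs G" "C \<inter> W = {0}" "C \<subset> vecs G \<or> W = {0}"
    "lift_join (E \<inter> W, W - {0}) (E \<inter> C, C - {0}) \<simeq> (E, G)"
proof -
  have G: "finite (vecs G)" "f2.subspace (vecs G)" and E: "0 \<notin> E" "E \<subseteq> vecs G"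
    using mat by (auto simp: matroid_iff vecs_def)
  obtain C where C: "f2.subspace C" "C \<subseteq> vecs G" "C \<inter> W = {0}"
    and sum: "\<forall>v\<in>vecs G. \<exists>w\<in>W. \<exists>c\<in>C. v = w + c"
    using complement_exists[OF G W] .
  have vecs: "vecs (W - {0}) = W" "vecs (C - {0}) = C"
    using W C by (simp_all add: vecs_Diff f2_subspace_iff)
  have inj: "w = w' \<and> c = c'" if "w \<in> W" "w' \<in> W" "c \<in> C" "c' \<in> C" "w + c = w' + c'" for w w' c c'
  proof -
    have "w + w' = c + c'"
      using that(5) by (metis add.commute add.left_commute f2_add_left_self)
    moreover have "w + w' \<in> W" "c + c' \<in> C"
      using that W C by (simp_all add: f2_subspace_iff)
    ultimately have "w + w' = 0" "c + c' = 0"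
      using C(3) by auto
    then show ?thesis
      by (simp add: f2_add_eq_0_iff)
  qed
  have in_E: "w + c \<in> E \<longleftrightarrow> c = 0 \<and> w \<in> E \<or> c \<in> E" if "w \<in> W" "c \<in> C" for w c
  proof (cases "c = 0")
    case False
    then have "c \<notin> W" "c \<in> vecs G" "w \<in> vecs G"
      using that C W by auto
    moreover from this have "c + w \<notin> W" "c + w \<in> vecs G"
      using f2_subspace_add_iff(1)[OF W(1) that(1)] G by (simp_all add: f2_subspace_iff)
    \<comment> \<open>Adding \<open>w\<close> twice returns to \<open>c\<close>, so
      \<open>inv\<close> yields both directions of the equivalence.\<close>
    moreover have "c + w + w \<in> E \<longleftrightarrow> c \<in> E" "w + c \<in> E \<longleftrightarrow> c + w \<in> E"
      by (simp_all only: f2_ac)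
    ultimately show ?thesis
      using inv[of c w] inv[of "c + w" w] that False by blast
  qed (use E in auto)
  have "lift_join (E \<inter> W, W - {0}) (E \<inter> C, C - {0}) \<simeq> (E, G)"
    unfolding lift_join_eq
  proof (rule matroid_isoI[of "\<lambda>(w, c). w + c"], unfold vecs_lift_join, unfold vecs)
    show "bij_betw (\<lambda>(w, c). w + c) (W \<times> C) (vecs G)"
      unfolding bij_betw_def
    proof
      show "inj_on (\<lambda>(w, c). w + c) (W \<times> C)"
        using inj by (auto simp: inj_on_def)
      show "(\<lambda>(w, c). w + c) ` (W \<times> C) = vecs G"
      proof
        show "(\<lambda>(w, c). w + c) ` (W \<times> C) \<subseteq> vecs G"
          using W C G by (auto simp: f2_subspace_iff subset_iff)
        show "vecs G \<subseteq> (\<lambda>(w, c). w + c) ` (W \<times> C)"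
          using sum by force
      qed
    qed
    show "(\<lambda>(w, c). w + c) ` ((E \<inter> W) \<times> {0} \<union> W \<times> (E \<inter> C)) = E" (is "?f ` ?S = E")
    proof
      show "?f ` ?S \<subseteq> E"
        using in_E C(3) by auto
      show "E \<subseteq> ?f ` ?S"
      proof
        fix v
        assume v: "v \<in> E"
        then obtain w c where wc: "w \<in> W" "c \<in> C" "v = w + c"
          using sum E by blast
        then have "(w, c) \<in> ?S"
          using in_E[OF wc(1,2)] v by auto
        then show "v \<in> ?f ` ?S"
          using wc(3) by force
      qed
    qed
  qed (auto simp: add_ac)
  moreover have "C \<subset> vecs G \<or> W = {0}"
    using C W by blast
  ultimately show ?thesis
    by (intro that[OF C])
qed

section \<open>Prime claw-free matroids are basic\<close>

lemma even_card_Int_iff: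
  assumes "finite P"
  shows "even (card (E \<inter> P)) \<longleftrightarrow> (\<Sum>p\<in>P. of_bool (p \<in> E)) = (0 :: bit)"
proof -
  have "(of_nat n :: bit) = 0 \<longleftrightarrow> even n" for n
    by (induction n) auto
  moreover have "(\<Sum>p\<in>P. of_bool (p \<in> E)) = (of_nat (card (E \<inter> P)) :: bit)"
    using assms by (simp add: of_bool_def sum.If_cases Int_commute)
  ultimately show ?thesis
    by simp
qed

lemma sum_plane:
  fixes g :: "'a::f2_vector \<Rightarrow> 'b::comm_monoid_add"
  assumes "0 \<notin> {x, y, z, x + y, x + z, y + z, x + y + z}"
  shows "sum g {x, y, z, x + y, x + z, y + z, x + y + z} =
    g x + g y + g z + g (x + y) + g (x + z) + g (y + z) + g (x + y + z)"
proof -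
  have nz: "x \<noteq> 0" "y \<noteq> 0" "z \<noteq> 0" "x + y \<noteq> 0" "x + z \<noteq> 0" "y + z \<noteq> 0" "x + y + z \<noteq> 0"
    by (rule notI, rule notE[OF assms], simp)+
  \<comment> \<open>The seven vectors are distinct because the sum of any two of them is again one
    of the seven, hence nonzero.\<close>
  have neq: "u \<noteq> v" if "u + v = w" "w \<noteq> 0" for u v w :: 'a
    using that by auto
  have "y + z \<noteq> x + y + z"
    by (rule neq[OF _ nz(1)]) (simp only: f2_ac)
  moreover have "x + z \<noteq> y + z" "x + z \<noteq> x + y + z"
    by (rule neq[OF _ nz(4)], simp only: f2_ac, rule neq[OF _ nz(2)], simp only: f2_ac)
  moreover have "x + y \<noteq> x + z" "x + y \<noteq> y + z" "x + y \<noteq> x + y + z"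
    by (rule neq[OF _ nz(6)], simp only: f2_ac, rule neq[OF _ nz(5)], simp only: f2_ac,
        rule neq[OF _ nz(3)], simp only: f2_ac)
  moreover have "z \<noteq> x + y" "z \<noteq> x + z" "z \<noteq> y + z" "z \<noteq> x + y + z"
    by (rule neq[OF _ nz(7)], simp only: f2_ac, rule neq[OF _ nz(1)], simp only: f2_ac,
        rule neq[OF _ nz(2)], simp only: f2_ac, rule neq[OF _ nz(4)], simp only: f2_ac)
  moreover have "y \<noteq> z" "y \<noteq> x + y" "y \<noteq> x + z" "y \<noteq> y + z" "y \<noteq> x + y + z"
    by (rule neq[OF _ nz(6)], simp only: f2_ac, rule neq[OF _ nz(1)], simp only: f2_ac,
        rule neq[OF _ nz(7)], simp only: f2_ac, rule neq[OF _ nz(3)], simp only: f2_ac,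
        rule neq[OF _ nz(5)], simp only: f2_ac)
  moreover have "x \<noteq> y" "x \<noteq> z" "x \<noteq> x + y" "x \<noteq> x + z" "x \<noteq> y + z" "x \<noteq> x + y + z"
    by (rule neq[OF _ nz(4)], simp only: f2_ac, rule neq[OF _ nz(5)], simp only: f2_ac,
        rule neq[OF _ nz(2)], simp only: f2_ac, rule neq[OF _ nz(3)], simp only: f2_ac,
        rule neq[OF _ nz(7)], simp only: f2_ac, rule neq[OF _ nz(6)], simp only: f2_ac)
  ultimately show ?thesis
    by (simp only: sum.insert finite.intros sum.empty insert_iff empty_iff simp_thms add_0_right add.assoc)
qed

lemma prime_claw_free_basic:
  fixes E G :: "'a::f2_vector set"
  assumes mat: "matroid (E, G)" and free: "claw_free (E, G)"
    and prime: "\<And>W. \<lbrakk>f2.subspace W; W \<subseteq> vecs G;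
      \<And>v w. \<lbrakk>v \<in> vecs G; v \<notin> W; w \<in> W; v \<in> E\<rbrakk> \<Longrightarrow> v + w \<in> E\<rbrakk> \<Longrightarrow> W = {0} \<or> W = vecs G"
  shows "basic_matroid (E, G)"
proof (cases "E = {}")
  \<comment> \<open>The empty set is a union of two empty flats. It is treated separately because
    \<open>prime_claw_free_set\<close> asks for a red vector.\<close>
  case True
  then have "PG_sum (E, G)"
    unfolding PG_sum_def flat_def by (intro exI[of _ "{}"]) (simp add: vecs_def)
  then show ?thesis
    using mat by (simp add: basic_matroid_def)
next
  case False
  have G: "0 \<notin> G" "finite (vecs G)" "f2.subspace (vecs G)" and E: "0 \<notin> E" "E \<subseteq> G"
    using mat by (auto simp: matroid_iff vecs_def)
  interpret prime_claw_free_set "vecs G" E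
  proof
    show "x + y + z \<in> E" if "x \<in> E" "y \<in> E" "z \<in> E" "x + y \<notin> E" "x + z \<notin> E" "y + z \<notin> E" for x y z
      using free that unfolding claw_free_iff[OF mat] by blast
  qed (use G E False prime in \<open>auto simp: vecs_def\<close>)
  have "PG_sum (E, G) \<or> even_plane (E, G) \<or> (\<exists>N. matroid N \<and> triangle_free N \<and> (E, G) = complement N)"
  proof (rule prime_claw_free_cases)
    fix L1 L2
    assume L: "f2.subspace L1" "f2.subspace L2" "L1 \<subseteq> vecs G" "L2 \<subseteq> vecs G" "L1 \<inter> L2 = {0}"
      "E = L1 \<union> L2 - {0}"
    have "flat G (L1 - {0})" "flat G (L2 - {0})"
      using L by (auto simp: flat_def vecs_Diff f2_subspace_iff) (auto simp: vecs_def)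
    moreover have "(L1 - {0}) \<inter> (L2 - {0}) = {}" "E = (L1 - {0}) \<union> (L2 - {0})"
      using L by auto
    ultimately have "PG_sum (E, G)"
      unfolding PG_sum_def fst_conv snd_conv by blast
    then show ?thesis ..
  next
    assume sum0: "\<And>x y z. x \<in> vecs G \<Longrightarrow> y \<in> vecs G \<Longrightarrow> z \<in> vecs G \<Longrightarrow>
      of_bool (x \<in> E) + of_bool (y \<in> E) + of_bool (z \<in> E)
      + of_bool (x + y \<in> E) + of_bool (x + z \<in> E) + of_bool (y + z \<in> E) + of_bool (x + y + z \<in> E)
      = (0 :: bit)"
    have "even (card (E \<inter> P))" if P: "plane G P" for P
    proof -
      have "P \<subseteq> G" and vecs_P: "f2.subspace (vecs P)" "f2.dim (vecs P) = 3"
        using P by (simp_all add: plane_def flat_def flat_dim_def)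
      obtain x y z where ne: "0 \<notin> {x, y, z, x + y, x + z, y + z, x + y + z}"
        and vP: "vecs P = {0, x, y, z, x + y, x + z, y + z, x + y + z}"
        using vecs_P by (rule dim_three)
      define Q where "Q = {x, y, z, x + y, x + z, y + z, x + y + z}"
      have "0 \<notin> P" "0 \<notin> Q"
        using \<open>P \<subseteq> G\<close> G ne by (auto simp: Q_def)
      moreover have "insert 0 P = insert 0 Q"
        using vP by (simp add: vecs_def Q_def)
      ultimately have PQ: "P = Q"
        by (rule insert_ident[THEN iffD1])
      have V: "x \<in> vecs G" "y \<in> vecs G" "z \<in> vecs G"
        using \<open>P \<subseteq> G\<close> unfolding PQ Q_def vecs_def by auto
      have "(\<Sum>p\<in>Q. of_bool (p \<in> E)) = (0 :: bit)"
        unfolding Q_def sum_plane[OF ne] using V by (rule sum0)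
      then show ?thesis
        by (simp only: even_card_Int_iff PQ Q_def finite.intros)
    qed
    then have "even_plane (E, G)"
      by (simp add: even_plane_def)
    then show ?thesis by blast
  next
    assume no_triangle: "\<And>x y. x \<in> vecs G - E \<Longrightarrow> y \<in> vecs G - E \<Longrightarrow> x \<noteq> 0 \<Longrightarrow> y \<noteq> 0 \<Longrightarrow>
      x \<noteq> y \<Longrightarrow> x + y \<in> E"
    have "matroid (G - E, G)"
      using mat by (auto simp: matroid_iff)
    moreover have "(E, G) = complement (G - E, G)"
      using E by (auto simp: complement_def)
    moreover have "triangle_free (G - E, G)"
      unfolding triangle_free_def fst_conv snd_conv
    proof (intro notI, elim exE conjE)
      fix T
      assume T: "triangle G T" "T \<subseteq> G - E"
      then obtain x y where xy: "x \<noteq> 0" "y \<noteq> 0" "x \<noteq> y" "vecs T = {0, x, y, x + y}"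
        using dim_two[of "vecs T"] by (auto simp: triangle_def flat_def flat_dim_def)
      have "u \<in> T" if "u \<in> {x, y, x + y}" for u
      proof -
        have "u \<in> vecs T" "u \<noteq> 0"
          using that xy by (auto simp: f2_add_eq_0_iff)
        then show ?thesis by (simp add: vecs_def)
      qed
      then have "x \<in> T" "y \<in> T" "x + y \<in> T" by simp_all
      then show False
        using no_triangle[of x y] xy T(2) by (auto simp: vecs_def)
    qed
    ultimately show ?thesis by blast
  qed
  then show ?thesis
    using mat by (simp add: basic_matroid_def)
qed

section \<open>Induction on the size of the space\<close>

lemma matroid_subspace:
  assumes "matroid (E, G)" "f2.subspace W" "W \<subseteq> vecs G"
  shows "matroid (E \<inter> W, W - {0})" "claw_free (E, G) \<Longrightarrow> claw_free (E \<inter> W, W - {0})"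
proof -
  have "finite (vecs G)" "0 \<notin> E"
    using assms(1) by (auto simp: matroid_iff vecs_def)
  then have "finite W"
    using assms(3) finite_subset by blast
  then show mat: "matroid (E \<inter> W, W - {0})"
    using assms(2) \<open>0 \<notin> E\<close> by (auto simp: matroid_iff vecs_Diff f2_subspace_iff)
  show "claw_free (E \<inter> W, W - {0})" if "claw_free (E, G)"
    using that assms(2) unfolding claw_free_iff[OF mat] claw_free_iff[OF assms(1)]
    by (simp add: f2_subspace_iff)
qed

lemma claw_free_obtainable:
  fixes M :: "f2_seq matroid"
  assumes "matroid M" "claw_free M"
  shows "\<exists>N. obtainable N \<and> M \<simeq> N"
  using assms
proof (induction "card (vecs (snd M))" arbitrary: M rule: less_induct)
  case less
  obtain E G where M: "M = (E, G)" by fastforce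
  have mat: "matroid (E, G)" and free: "claw_free (E, G)"
    using less.prems by (simp_all add: M)
  have fin: "finite (vecs G)"
    using mat by (simp add: matroid_iff vecs_def)
  show ?case
  \<comment> \<open>A factor other than \<open>{0}\<close> and the whole space gives two smaller
    matroids: \<open>W \<noteq> vecs G\<close> makes the first one smaller,
    \<open>W \<noteq> {0}\<close> the second. Without such a factor the matroid is prime and hence
    basic.\<close>
  proof (cases "\<exists>W. f2.subspace W \<and> W \<subseteq> vecs G \<and>
      (\<forall>v\<in>vecs G - W. \<forall>w\<in>W. v \<in> E \<longrightarrow> v + w \<in> E) \<and> W \<noteq> {0} \<and> W \<noteq> vecs G")
    case True
    then obtain W where W: "f2.subspace W" "W \<subseteq> vecs G" "W \<noteq> {0}" "W \<subset> vecs G"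
      and inv: "\<And>v w. v \<in> vecs G \<Longrightarrow> v \<notin> W \<Longrightarrow> w \<in> W \<Longrightarrow> v \<in> E \<Longrightarrow> v + w \<in> E"
      by blast
    obtain C where C: "f2.subspace C" "C \<subseteq> vecs G" "C \<inter> W = {0}" "C \<subset> vecs G \<or> W = {0}"
      and iso: "lift_join (E \<inter> W, W - {0}) (E \<inter> C, C - {0}) \<simeq> (E, G)"
      using decompose_lift_join[OF mat W(1,2) inv] .
    have IH: "\<exists>N. obtainable N \<and> (E \<inter> S, S - {0}) \<simeq> N" if S: "f2.subspace S" "S \<subset> vecs G" for S
    proof (rule less.hyps)
      have "vecs (S - {0}) = S"
        using S by (simp add: vecs_Diff f2_subspace_iff)
      then show "card (vecs (snd (E \<inter> S, S - {0}))) < card (vecs (snd M))"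
        using psubset_card_mono[OF fin S(2)] by (simp add: M)
    qed (use matroid_subspace[OF mat S(1)] S free in auto)
    obtain N1 N2 where N: "obtainable N1" "(E \<inter> W, W - {0}) \<simeq> N1"
      "obtainable N2" "(E \<inter> C, C - {0}) \<simeq> N2"
      using IH[OF W(1,4)] IH[OF C(1)] C(4) W(3) by blast
    have mats: "matroid (E \<inter> W, W - {0})" "matroid (E \<inter> C, C - {0})"
      using matroid_subspace[OF mat] W C by blast+
    have "(E, G) \<simeq> lift_join (E \<inter> W, W - {0}) (E \<inter> C, C - {0})"
      using matroid_iso_sym[OF matroid_lift_join[OF mats] iso] .
    also have "lift_join (E \<inter> W, W - {0}) (E \<inter> C, C - {0}) \<simeq> lift_join N1 N2"
      using N mats by (intro lift_join_cong)
    finally (matroid_iso_trans) have "(E, G) \<simeq> N1 \<otimes> N2"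
      using lift_join_iso_lift_join_seq by (rule matroid_iso_trans)
    then show ?thesis
      using N obtainable.lift_join M by blast
  next
    case False
    then have "basic_matroid (E, G)"
      by (intro prime_claw_free_basic[OF mat free]) blast
    moreover have "(E, G) \<simeq> (E, G)"
      by (rule matroid_isoI[of id]) auto
    ultimately show ?thesis
      using obtainable.basic M by blast
  qed
qed

text \<open>So this class is one of those intersected in \<open>smallest_class\<close>, whose
  members are therefore claw-free.\<close>

lemma claw_free_class_closed: "lift_join_closed {M. matroid M \<and> claw_free M}"
proof -
  have "matroid N \<and> claw_free N" if "basic_matroid N" for N :: "f2_seq matroid"
    using basic_claw_free[OF that] that by (simp add: basic_matroid_def)
  moreover have "claw_free N" if "matroid M" "claw_free M" "matroid N \<and> M \<simeq> N" for M N :: "f2_seq matroid"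
    using claw_free_iso that by blast
  moreover note matroid_lift_join_seq claw_free_lift_join_seq
  ultimately show ?thesis
    unfolding lift_join_closed_def mem_Collect_eq by blast
qed

lemma obtainable_smallest_class: "obtainable N \<Longrightarrow> N \<in> smallest_class"
proof (induction rule: obtainable.induct)
  case (basic M)
  then show ?case
    unfolding smallest_class_def lift_join_closed_def by blast
next
  case (lift_join M1 M2)
  then show ?case
    unfolding smallest_class_def lift_join_closed_def by blast
qed

theorem theorem1p1:
  fixes M :: "'a::f2_vector matroid"
  assumes "matroid M"
  shows "(claw_free M \<longleftrightarrow> (\<exists>N. obtainable N \<and> M \<simeq> N)) \<and>
         (claw_free M \<longleftrightarrow> in_class M smallest_class)"
proof -
  \<comment> \<open>The equivalences follow from a cycle: claw-free matroids are obtainable up to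
    isomorphism, these lie in the smallest class, and its members are claw-free. The first step
    passes to a copy in \<open>f2_seq\<close>, where \<open>obtainable\<close> is defined.\<close>
  have 1: "\<exists>N. obtainable N \<and> M \<simeq> N" if "claw_free M"
  proof -
    obtain M' :: "f2_seq matroid" where M': "matroid M'" "M \<simeq> M'"
      using iso_f2_seq[OF assms] .
    then have "claw_free M'"
      using claw_free_iso assms that by blast
    then obtain N where "obtainable N" "M' \<simeq> N"
      using claw_free_obtainable M'(1) by blast
    then show ?thesis
      using matroid_iso_trans[OF M'(2)] by blast
  qed
  have 2: "in_class M smallest_class" if "obtainable N" "M \<simeq> N" for N
    using that obtainable_smallest_class unfolding in_class_def by blast
  have 3: "claw_free M" if in_class: "in_class M smallest_class"
  proof -
    obtain N where N: "N \<in> smallest_class" "M \<simeq> N"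
      using in_class unfolding in_class_def by blast
    then have "matroid N" "claw_free N"
      using claw_free_class_closed unfolding smallest_class_def by blast+
    then show ?thesis
      using claw_free_iso matroid_iso_sym assms N(2) by blast
  qed
  show ?thesis
    using 1 2 3 by blast
qed

end
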